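(* Let $f$ be convex and satisfy, for some $G\ge0$, $L>0$ and all $x,y\in\mathcal X$, $$f(y)\le f(x)+\langle\nabla f(x),y-x\rangle+G\|y-x\|+\tfrac L2\|y-x\|^2 .$$ Suppose that $x^*\in\arg\min_{x\in\mathcal X}f(x)$ exists and that the gradient oracle is unbiased with $\sigma$-sub-Gaussian noise (see context). Let $\delta\in(0,1)$, $T\ge1$, and run Accelerated Stochastic Mirror Descent with step sizes $\{\eta_t\}$ for $T$ iterations. (1) If $\eta_t=\min\left\{\dfrac{t}{4L},\ \dfrac{\sqrt{\mathbf D_\psi(x^*,z_0)}\;t}{\sqrt6\sqrt{G^2+\sigma^2(1+\log\frac1\delta)}\;T^{3/2}}\right\}$, then with probability at least $1-\delta$ both $\mathbf D_\psi(x^*,z_T)\le4\mathbf D_\psi(x^*,z_0)$ and $$f(y_T)-f(x^* )\le\frac{16L\,\mathbf D_\psi(x^*,z_0)}{T^2}+\frac{8\sqrt6}{\sqrt T}\sqrt{\mathbf D_\psi(x^*,z_0)\Big(G^2+\big(1+\log\tfrac1\delta\big)\sigma^2\Big)}.$$ (2) If $\eta_t=\min\left\{\dfrac{t}{4L},\ \dfrac{\sqrt{\mathbf D_\psi(x^*,z_0)}}{\sqrt6\sqrt{G^2+\sigma^2(1+\log\frac1\delta)}\;t^{1/2}}\right\}$, then with probability at least $1-\delta$ both $\mathbf D_\psi(x^*,z_T)\le2(2+\log T)\mathbf D_\psi(x^*,z_0)$ and $$f(y_T)-f(x^* )\le\frac{16L\,\mathbf D_\psi(x^*,z_0)}{T^2}+\frac{4\sqrt6(2+\log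 T)}{\sqrt T}\sqrt{\mathbf D_\psi(x^*,z_0)\Big(G^2+\big(1+\log\tfrac1\delta\big)\sigma^2\Big)}.$$
   Context: $\mathcal X\subseteq\mathbb R^d$ is a nonempty convex set (not necessarily bounded), $f:\mathbb R^d\to\mathbb R$ is convex with gradient $\nabla f$. $\|\cdot\|$ is a general norm on $\mathbb R^d$ with dual norm $\|\cdot\|_*$. $\psi:\mathbb R^d\to\mathbb R$ is a differentiable mirror map that is $1$-strongly convex on $\mathcal X$ with respect to $\|\cdot\|$, and $\mathbf D_\psi(x,y)=\psi(x)-\psi(y)-\langle\nabla\psi(y),x-y\rangle$. Accelerated Stochastic Mirror Descent: start from deterministic $x_0=y_0=z_0\in\mathcal X$; for $t=1,\dots,T$, with $\alpha_t=\frac2{t+1}$: $x_t=(1-\alpha_t)y_{t-1}+\alpha_tz_{t-1}$; $z_t=\arg\min_{x\in\mathcal X}\left(\eta_t\langle\widehat\nabla f(x_t),x\rangle+\mathbf D_\psi(x,z_{t-1})\right)$ (minimizers are assumed to exist); $y_t=(1-\alpha_t)y_{t-1}+\alpha_tz_t$. Output $y_T$. Noise assumptions: a random variable $Y$ is $\sigma$-sub-Gaussian ($\sigma>0$) if $\mathbb E[\exp(\lambda^2Y^2)]\le\exp(\lambda^2\sigma^2)$ for all $|\lambda|\le 1/\sigma$. $\widehat\nabla f(x)$ is a history-independent stochastic gradient oracle with $\mathbb E[\widehat\nabla f(x)\mid x]=\nabla f(x)$ and $\|\widehat\nabla f(x)-\nabla f(x)\|_*$ $\sigma$-sub-Gaussian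 for every $x\in\mathcal X$. Thus, with $\xi_t=\widehat\nabla f(x_t)-\nabla f(x_t)$ and $\mathcal F_t=\sigma(\xi_1,\dots,\xi_{t-1})$ (so $x_t,z_{t-1},y_{t-1}$ are $\mathcal F_t$-measurable): $\mathbb E[\xi_t\mid\mathcal F_t]=0$ and $\mathbb E[\exp(\lambda^2\|\xi_t\|_*^2)\mid\mathcal F_t]\le\exp(\lambda^2\sigma^2)$ for all $|\lambda|\le1/\sigma$. *)

theory Defs
  imports "HOL-Probability.Probability"
begin

text \<open>The ambient norm is an arbitrary norm on \<open>\<real>\<^sup>d\<close>, in general different from the Euclidean
  norm of the type class, so it is passed as a function.\<close>

definition is_norm :: "('a::real_vector \<Rightarrow> real) \<Rightarrow> bool" where
  "is_norm N \<longleftrightarrow>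
     (\<forall>x. N x = 0 \<longleftrightarrow> x = 0) \<and>
     (\<forall>c x. N (c *\<^sub>R x) = \<bar>c\<bar> * N x) \<and>
     (\<forall>x y. N (x + y) \<le> N x + N y)"

definition dual_norm :: "('a::real_inner \<Rightarrow> real) \<Rightarrow> 'a \<Rightarrow> real" where
  "dual_norm N v = (SUP x\<in>{x. N x \<le> 1}. v \<bullet> x)"

definition strongly_convex_on :: "'a::real_vector set \<Rightarrow> real \<Rightarrow> ('a \<Rightarrow> real) \<Rightarrow> ('a \<Rightarrow> real) \<Rightarrow> bool" where
  "strongly_convex_on S \<mu> N \<psi> \<longleftrightarrow>
     (\<forall>x\<in>S. \<forall>y\<in>S. \<forall>u\<in>{0..1}.
        \<psi> ((1 - u) *\<^sub>R x + u *\<^sub>R y)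
          \<le> (1 - u) * \<psi> x + u * \<psi> y - \<mu> / 2 * u * (1 - u) * (N (x - y))\<^sup>2)"

text \<open>The second argument \<open>grad_\<psi>\<close> stands for the gradient field of \<open>\<psi>\<close>.\<close>

definition bregman :: "('a::real_inner \<Rightarrow> real) \<Rightarrow> ('a \<Rightarrow> 'a) \<Rightarrow> 'a \<Rightarrow> 'a \<Rightarrow> real" where
  "bregman \<psi> grad_\<psi> x y = \<psi> x - \<psi> y - grad_\<psi> y \<bullet> (x - y)"

text \<open>One realisation of accelerated (stochastic) mirror descent; \<open>g t\<close> is the gradient estimate
  the oracle returned at the query point \<open>x t\<close>.\<close>

definition asmd_path ::
  "'a::real_inner set \<Rightarrow> ('a \<Rightarrow> real) \<Rightarrow> ('a \<Rightarrow> 'a) \<Rightarrow> (nat \<Rightarrow> real) \<Rightarrow> nat \<Rightarrow> 'a \<Rightarrow>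
   (nat \<Rightarrow> 'a) \<Rightarrow> (nat \<Rightarrow> 'a) \<Rightarrow> (nat \<Rightarrow> 'a) \<Rightarrow> (nat \<Rightarrow> 'a) \<Rightarrow> bool" where
  "asmd_path X \<psi> grad_\<psi> \<eta> T x\<^sub>0 g x y z \<longleftrightarrow>
     x 0 = x\<^sub>0 \<and> y 0 = x\<^sub>0 \<and> z 0 = x\<^sub>0 \<and>
     (\<forall>t\<in>{1..T}. let \<alpha> = 2 / (real t + 1) in
        x t = (1 - \<alpha>) *\<^sub>R y (t - 1) + \<alpha> *\<^sub>R z (t - 1) \<and>
        is_arg_min (\<lambda>u. \<eta> t * (g t \<bullet> u) + bregman \<psi> grad_\<psi> u (z (t - 1))) (\<lambda>u. u \<in> X) (z t) \<and>
        y t = (1 - \<alpha>) *\<^sub>R y (t - 1) + \<alpha> *\<^sub>R z t)"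

text \<open>The \<open>\<sigma>\<close>-algebra generated by \<open>\<xi> 1, \<dots>, \<xi> (t - 1)\<close>; it is trivial for \<open>t = 1\<close>.\<close>

definition noise_history :: "'w measure \<Rightarrow> (nat \<Rightarrow> 'w \<Rightarrow> 'a::topological_space) \<Rightarrow> nat \<Rightarrow> 'w measure" where
  "noise_history M \<xi> t =
     sigma (space M) {\<xi> s -` A \<inter> space M | s A. s \<in> {1..<t} \<and> A \<in> sets borel}"

text \<open>\<open>real_cond_exp\<close> covers real-valued functions only, so the conditional mean of a random
  vector is taken along the basis vectors.  Integrability is explicit because \<open>real_cond_exp\<close> is
  total.\<close>

definition cond_mean_zero :: "'w measure \<Rightarrow> 'w measure \<Rightarrow> ('w \<Rightarrow> 'a::euclidean_space) \<Rightarrow> bool" where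
  "cond_mean_zero M F Y \<longleftrightarrow>
     integrable M Y \<and>
     (\<forall>b\<in>Basis. AE \<omega> in M. real_cond_exp M F (\<lambda>\<omega>. Y \<omega> \<bullet> b) \<omega> = 0)"

text \<open>The \<open>ennreal\<close>-valued conditional expectation makes the bound include finiteness of the
  conditional exponential moment.\<close>

definition cond_subgaussian :: "'w measure \<Rightarrow> 'w measure \<Rightarrow> real \<Rightarrow> ('w \<Rightarrow> real) \<Rightarrow> bool" where
  "cond_subgaussian M F \<sigma> Y \<longleftrightarrow>
     (\<forall>l. \<bar>l\<bar> \<le> 1 / \<sigma> \<longrightarrow>
        (AE \<omega> in M. nn_cond_exp M F (\<lambda>\<omega>. ennreal (exp (l\<^sup>2 * (Y \<omega>)\<^sup>2))) \<omega>
                      \<le> ennreal (exp (l\<^sup>2 * \<sigma>\<^sup>2))))"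

end

theory Submission
  imports Defs
begin

text \<open>Write \<open>\<xi> t\<close> for the noise, \<open>\<Delta> t = f (y t) - f xstar\<close> and \<open>D t\<close> for the Bregman divergence of
  \<open>xstar\<close> from \<open>z t\<close>. Smoothness at \<open>x t\<close>, convexity and the three-point inequality of the mirror
  step give (\<open>accelerated_step\<close>)

  \<open>(t + 1) / 2 * \<eta> t * \<Delta> t + D t \<le> (t - 1) / 2 * \<eta> t * \<Delta> (t - 1) + D (t - 1)
    + \<eta> t * (\<xi> t \<bullet> (xstar - z (t - 1))) + 2 * (\<eta> t)\<^sup>2 * (G\<^sup>2 + \<parallel>\<xi> t\<parallel>\<^sub>*\<^sup>2)\<close>,

  and since \<open>\<eta> t / t\<close> is nonincreasing these inequalities telescope. What remains is to control
  the noise on the right. Its inner product term has conditional mean zero but a size proportional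
  to \<open>N (xstar - z (t - 1))\<close>, which is not bounded because \<open>X\<close> is not. By strong convexity it
  is at most \<open>sqrt (2 * D (t - 1))\<close>, so the remedy is to multiply step \<open>t\<close> by a weight \<open>w t\<close>
  and to let the weights decrease just fast enough that the difference
  \<open>(w (t - 1) - w t) * D (t - 1)\<close> on the left pays for the conditional exponential moment of the
  noise (\<open>weighted_path_bound\<close>). The exponential of the weighted and compensated noise is then a
  supermartingale (\<open>nn_integral_noise_increment_le\<close>), Markov's inequality bounds it
  (\<open>noise_concentration\<close>), and, as the weights vary by a factor of two only, with probability at
  least \<open>1 - \<delta>\<close>

  \<open>(T + 1) / 2 * \<eta> T * \<Delta> T + D T \<le> 2 * D 0 + 12 * S * (\<Sum>t=1..T. (\<eta> t)\<^sup>2)\<close>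

  (\<open>high_probability_bound\<close>). Both schedules are tuned so that the second term on the right is of the
  order of the first, up to the logarithm in the second case (\<open>schedule_guarantee\<close>).

  The probabilistic part needs the iterates to be functions of the past noise. The minimizer in the
  mirror step is a Lipschitz function of its linear term (\<open>mirror_step_measurable\<close>), and gradients
  are Borel as limits of difference quotients (\<open>gradient_measurable\<close>). If \<open>D 0 = 0\<close>, all steps
  vanish and the iterates rest at the minimizer.\<close>

section \<open>Arbitrary norms and their duals\<close>

locale general_norm =
  fixes N :: "'a::euclidean_space \<Rightarrow> real"
  assumes is_norm: "is_norm N"
begin

lemma norm_zero: "N 0 = 0"
  and norm_eq_zero: "N x = 0 \<longleftrightarrow> x = 0"
  and norm_scale: "N (c *\<^sub>R x) = \<bar>c\<bar> * N x"
  and norm_triangle: "N (x + y) \<le> N x + N y"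
  using is_norm unfolding is_norm_def by auto

lemma norm_uminus: "N (- x) = N x"
  using norm_scale[of "- 1" x] by simp

lemma norm_nonneg: "0 \<le> N x"
  using norm_triangle[of x "- x"] norm_uminus[of x] norm_zero by simp

lemma norm_diff_commute: "N (x - y) = N (y - x)"
  using norm_uminus[of "x - y"] by simp

lemma norm_continuous: "continuous_on UNIV N"
proof (rule convex_on_continuous)
  show "convex_on UNIV N"
  proof (rule convex_onI)
    fix t :: real and x y assume "0 < t" "t < 1"
    then show "N ((1 - t) *\<^sub>R x + t *\<^sub>R y) \<le> (1 - t) * N x + t * N y"
      using norm_triangle[of "(1 - t) *\<^sub>R x" "t *\<^sub>R y"] by (simp add: norm_scale)
  qed simp
qed simp

lemma norm_measurable [measurable]: "N \<in> borel_measurable borel"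
  using norm_continuous by (rule borel_measurable_continuous_onI)

text \<open>The unit sphere is compact, so the continuous function \<open>N\<close> is bounded above and away from
  zero on it; homogeneity does the rest.\<close>

lemma norm_equivalent:
  obtains m K where "0 < m" "0 < K" "\<And>x. m * norm x \<le> N x" "\<And>x. N x \<le> K * norm x"
proof -
  have S: "compact (sphere 0 1 :: 'a set)" "sphere 0 1 \<noteq> ({} :: 'a set)"
    by auto
  have c: "continuous_on (sphere 0 1) N"
    using norm_continuous continuous_on_subset by blast
  obtain a where a: "a \<in> sphere 0 1" "\<And>y. y \<in> sphere 0 1 \<Longrightarrow> N a \<le> N y"
    using continuous_attains_inf[OF S c] by blast
  obtain b where b: "b \<in> sphere 0 1" "\<And>y. y \<in> sphere 0 1 \<Longrightarrow> N y \<le> N b"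
    using continuous_attains_sup[OF S c] by blast
  have Na: "0 < N a"
    using a(1) norm_nonneg[of a] norm_eq_zero[of a] by (cases "a = 0") auto
  have Nb: "0 < N b" using Na b(2)[OF a(1)] by simp
  have scaled: "N x = norm x * N (sgn x)" for x
    by (cases "x = 0") (auto simp: sgn_div_norm norm_scale norm_zero)
  have sgn: "sgn x \<in> sphere 0 1" if "x \<noteq> 0" for x :: 'a
    using that by (simp add: norm_sgn)
  have "N a * norm x \<le> N x" "N x \<le> N b * norm x" for x
    using scaled[of x] a(2)[OF sgn, of x] b(2)[OF sgn, of x]
    by (cases "x = 0"; simp add: norm_zero mult.commute mult_left_mono)+
  then show ?thesis using that Na Nb by blast
qed

lemma inner_le_dual_norm: "v \<bullet> x \<le> dual_norm N v * N x"
proof (cases "x = 0")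
  case False
  then have pos: "0 < N x" using norm_nonneg[of x] norm_eq_zero[of x] by linarith
  obtain m where m: "0 < m" "\<And>x. m * norm x \<le> N x" using norm_equivalent by metis
  have bdd: "bdd_above ((\<lambda>x. v \<bullet> x) ` {x. N x \<le> 1})"
  proof (rule bdd_aboveI2)
    fix u assume "u \<in> {x. N x \<le> 1}"
    then have "norm u \<le> 1 / m" using m(2)[of u] m(1) by (simp add: field_simps)
    then show "v \<bullet> u \<le> norm v * (1 / m)"
      using norm_cauchy_schwarz[of v u] mult_left_mono[of "norm u" "1 / m" "norm v"] norm_ge_zero[of v]
      by (meson order_trans)
  qed
  have "v \<bullet> (x /\<^sub>R N x) \<le> dual_norm N v"
    unfolding dual_norm_def using pos by (intro cSUP_upper bdd) (simp add: norm_scale)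
  then show ?thesis using pos by (simp add: field_simps)
qed (simp add: norm_zero)

lemma abs_inner_le_dual_norm: "\<bar>v \<bullet> x\<bar> \<le> dual_norm N v * N x"
  using inner_le_dual_norm[of v x] inner_le_dual_norm[of v "- x"] by (simp add: norm_uminus)

lemma dual_norm_leI:
  assumes "\<And>x. N x \<le> 1 \<Longrightarrow> v \<bullet> x \<le> c"
  shows "dual_norm N v \<le> c"
proof -
  have "0 \<in> {x. N x \<le> 1}" by (simp add: norm_zero)
  then have "{x. N x \<le> 1} \<noteq> {}" by blast
  then show ?thesis unfolding dual_norm_def using assms by (intro cSUP_least) auto
qed

lemma dual_norm_nonneg: "0 \<le> dual_norm N v"
proof -
  obtain b :: 'a where "b \<in> Basis" using nonempty_Basis by blast
  then have "0 < N b" using norm_nonneg[of b] norm_eq_zero[of b] nonzero_Basis by fastforce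
  moreover have "0 \<le> dual_norm N v * N b" using abs_inner_le_dual_norm[of v b] by linarith
  ultimately show ?thesis by (simp add: zero_le_mult_iff)
qed

lemma norm_le_dual_norm:
  obtains K where "0 < K" "\<And>v. norm v \<le> K * dual_norm N v"
proof -
  obtain K where K: "0 < K" "\<And>x. N x \<le> K * norm x" using norm_equivalent by metis
  have "norm v \<le> K * dual_norm N v" for v
  proof (cases "v = 0")
    case False
    have "v \<bullet> v \<le> dual_norm N v * N v" by (rule inner_le_dual_norm)
    also have "\<dots> \<le> dual_norm N v * (K * norm v)"
      using K(2) dual_norm_nonneg by (intro mult_left_mono)
    finally have "norm v * norm v \<le> (K * dual_norm N v) * norm v"
      by (simp add: dot_square_norm power2_eq_square ac_simps)
    then show ?thesis using False by simp
  qed (use K(1) dual_norm_nonneg[of v] in simp)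
  then show thesis using that K(1) by blast
qed

lemma dual_norm_measurable [measurable]: "dual_norm N \<in> borel_measurable borel"
proof (rule borel_measurable_continuous_onI, rule convex_on_continuous)
  show "convex_on UNIV (dual_norm N)"
  proof (rule convex_onI)
    fix t :: real and v w assume t: "0 < t" "t < 1"
    show "dual_norm N ((1 - t) *\<^sub>R v + t *\<^sub>R w) \<le> (1 - t) * dual_norm N v + t * dual_norm N w"
    proof (rule dual_norm_leI)
      fix x assume x: "N x \<le> 1"
      have le: "u \<bullet> x \<le> dual_norm N u" for u
        using inner_le_dual_norm[of u x] x dual_norm_nonneg[of u] mult_left_le[of "N x" "dual_norm N u"]
        by linarith
      show "((1 - t) *\<^sub>R v + t *\<^sub>R w) \<bullet> x \<le> (1 - t) * dual_norm N v + t * dual_norm N w"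
        using t le[of v] le[of w] by (simp add: inner_add_left add_mono mult_left_mono)
    qed
  qed simp
qed simp

end

section \<open>Gradients\<close>

lemma GDERIV_directional_limit:
  fixes a d :: "'a::real_inner"
  assumes "GDERIV h a :> v"
  shows "((\<lambda>s. (h (a + s *\<^sub>R d) - h a) / s) \<longlongrightarrow> v \<bullet> d) (at 0)"
proof -
  have "FDERIV h (a + 0 *\<^sub>R d) :> (\<lambda>h. h \<bullet> v)" using assms by (simp add: gderiv_def)
  moreover have "FDERIV (\<lambda>s. a + s *\<^sub>R d) 0 :> (\<lambda>s. s *\<^sub>R d)"
    by (auto intro!: derivative_eq_intros)
  ultimately have "FDERIV (\<lambda>s. h (a + s *\<^sub>R d)) 0 :> (\<lambda>s. (s *\<^sub>R d) \<bullet> v)"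
    by (rule has_derivative_compose[rotated])
  then have "DERIV (\<lambda>s. h (a + s *\<^sub>R d)) 0 :> v \<bullet> d"
    by (simp add: has_field_derivative_def inner_commute mult_commute_abs mult.commute)
  then show ?thesis by (simp add: DERIV_def)
qed

text \<open>Convexity, strong convexity and optimality over a convex set are all turned into statements
  about gradients in this way; the quadratic term is there for strong convexity.\<close>

lemma GDERIV_inner_le:
  fixes a d :: "'a::real_inner"
  assumes "GDERIV h a :> v"
    and le: "\<And>s. 0 < s \<Longrightarrow> s \<le> 1 \<Longrightarrow> h (a + s *\<^sub>R d) - h a \<le> s * c + s\<^sup>2 * e"
  shows "v \<bullet> d \<le> c"
proof (rule tendsto_le)
  show "((\<lambda>s. (h (a + s *\<^sub>R d) - h a) / s) \<longlongrightarrow> v \<bullet> d) (at_right 0)"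
    using GDERIV_directional_limit[OF assms(1)] by (rule tendsto_within_subset) simp
  have "((\<lambda>s. c + s * e) \<longlongrightarrow> c + 0 * e) (at_right 0)" by (intro tendsto_intros)
  then show "((\<lambda>s. c + s * e) \<longlongrightarrow> c) (at_right 0)" by simp
  have "(h (a + s *\<^sub>R d) - h a) / s \<le> c + s * e" if "0 < s" "s < 1" for s
    using le[of s] that by (simp add: divide_le_eq algebra_simps power2_eq_square)
  then show "\<forall>\<^sub>F s in at_right 0. (h (a + s *\<^sub>R d) - h a) / s \<le> c + s * e"
    unfolding eventually_at_right_field by (intro exI[of _ 1]) auto
qed simp

lemma GDERIV_continuous_on:
  assumes "\<And>u. GDERIV h u :> grad u"
  shows "continuous_on UNIV h"
proof (intro continuous_at_imp_continuous_on ballI)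
  fix u
  show "isCont h u" using assms[of u] unfolding gderiv_def by (rule has_derivative_continuous)
qed

text \<open>A gradient field need not be continuous, but it is a pointwise limit of difference quotients
  of a continuous function.\<close>

lemma gradient_measurable:
  fixes h :: "'a::euclidean_space \<Rightarrow> real"
  assumes grad: "\<And>u. GDERIV h u :> grad u"
  shows "grad \<in> borel_measurable borel"
proof (rule borel_measurable_euclidean_space[THEN iffD2], rule ballI)
  fix b :: 'a assume "b \<in> Basis"
  have [measurable]: "h \<in> borel_measurable borel"
    by (intro borel_measurable_continuous_onI GDERIV_continuous_on[of h grad] grad)
  show "(\<lambda>u. grad u \<bullet> b) \<in> borel_measurable borel"
  proof (rule borel_measurable_LIMSEQ_real)
    fix u
    have "filterlim (\<lambda>n. inverse (real (Suc n))) (at 0) sequentially"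
      using LIMSEQ_inverse_real_of_nat by (simp add: filterlim_at)
    then show "(\<lambda>n. (h (u + inverse (real (Suc n)) *\<^sub>R b) - h u) / inverse (real (Suc n)))
        \<longlonglongrightarrow> grad u \<bullet> b"
      by (rule filterlim_compose[OF GDERIV_directional_limit[OF grad]])
  qed measurable
qed

lemma convex_gradient_inequality:
  fixes f :: "'a::real_inner \<Rightarrow> real"
  assumes "convex_on UNIV f" "GDERIV f a :> v"
  shows "f a + v \<bullet> (b - a) \<le> f b"
proof -
  have "v \<bullet> (b - a) \<le> f b - f a"
  proof (rule GDERIV_inner_le[OF assms(2), where e = 0])
    fix s :: real assume "0 < s" "s \<le> 1"
    then have "f ((1 - s) *\<^sub>R a + s *\<^sub>R b) \<le> (1 - s) * f a + s * f b"
      using assms(1) by (intro convex_onD) auto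
    then show "f (a + s *\<^sub>R (b - a)) - f a \<le> s * (f b - f a) + s\<^sup>2 * 0"
      by (simp add: algebra_simps)
  qed
  then show ?thesis by simp
qed

section \<open>Mirror maps and the mirror step\<close>

locale mirror_map = general_norm N for N :: "'a::euclidean_space \<Rightarrow> real" +
  fixes X :: "'a set" and \<psi> :: "'a \<Rightarrow> real" and grad_\<psi> :: "'a \<Rightarrow> 'a"
  assumes convex_X: "convex X"
    and grad_\<psi>: "GDERIV \<psi> u :> grad_\<psi> u"
    and strongly_convex: "strongly_convex_on X 1 N \<psi>"
begin

abbreviation D where "D \<equiv> bregman \<psi> grad_\<psi>"

lemma bregman_lower:
  assumes "u \<in> X" "v \<in> X"
  shows "(N (u - v))\<^sup>2 / 2 \<le> D u v"
proof -
  have "grad_\<psi> v \<bullet> (u - v) \<le> \<psi> u - \<psi> v - (N (u - v))\<^sup>2 / 2"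
  proof (rule GDERIV_inner_le[OF grad_\<psi>])
    fix s :: real assume "0 < s" "s \<le> 1"
    then have "\<psi> ((1 - s) *\<^sub>R v + s *\<^sub>R u)
        \<le> (1 - s) * \<psi> v + s * \<psi> u - 1 / 2 * s * (1 - s) * (N (v - u))\<^sup>2"
      using strongly_convex assms unfolding strongly_convex_on_def by auto
    then show "\<psi> (v + s *\<^sub>R (u - v)) - \<psi> v
        \<le> s * (\<psi> u - \<psi> v - (N (u - v))\<^sup>2 / 2) + s\<^sup>2 * ((N (u - v))\<^sup>2 / 2)"
      by (simp add: algebra_simps power2_eq_square norm_diff_commute[of v u] diff_divide_distrib)
  qed
  then show ?thesis by (simp add: bregman_def)
qed

lemma bregman_nonneg: "u \<in> X \<Longrightarrow> v \<in> X \<Longrightarrow> 0 \<le> D u v"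
  by (rule order_trans[OF _ bregman_lower]) auto

lemma bregman_self: "D u u = 0"
  by (simp add: bregman_def)

lemma bregman_eq_zero:
  assumes "u \<in> X" "v \<in> X" "D u v \<le> 0"
  shows "u = v"
proof -
  have "(N (u - v))\<^sup>2 \<le> 0" using bregman_lower[OF assms(1,2)] assms(3) by linarith
  then show ?thesis using norm_eq_zero[of "u - v"] by simp
qed

text \<open>The mirror step is a minimization over a convex set, so at its solution \<open>z\<close> no direction
  pointing into the set is a direction of descent.\<close>

lemma mirror_step_optimality:
  assumes min: "is_arg_min (\<lambda>u. e * (g \<bullet> u) + D u z') (\<lambda>u. u \<in> X) z" and u: "u \<in> X"
  shows "0 \<le> (e *\<^sub>R g - grad_\<psi> z' + grad_\<psi> z) \<bullet> (u - z)"
proof -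
  have z: "z \<in> X" using min by (simp add: is_arg_min_def)
  have "- grad_\<psi> z \<bullet> (u - z) \<le> (e *\<^sub>R g - grad_\<psi> z') \<bullet> (u - z)"
  proof (rule GDERIV_inner_le[OF GDERIV_minus[OF grad_\<psi>], where e = 0])
    fix s :: real assume s: "0 < s" "s \<le> 1"
    have "z + s *\<^sub>R (u - z) = (1 - s) *\<^sub>R z + s *\<^sub>R u" by (simp add: algebra_simps)
    then have "z + s *\<^sub>R (u - z) \<in> X" using convexD[OF convex_X z u, of "1 - s" s] s by simp
    then have "e * (g \<bullet> z) + D z z' \<le> e * (g \<bullet> (z + s *\<^sub>R (u - z))) + D (z + s *\<^sub>R (u - z)) z'"
      using min by (auto simp: is_arg_min_def not_less)
    then show "- \<psi> (z + s *\<^sub>R (u - z)) - - \<psi> z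
        \<le> s * ((e *\<^sub>R g - grad_\<psi> z') \<bullet> (u - z)) + s\<^sup>2 * 0"
      by (simp add: bregman_def algebra_simps)
  qed
  then show ?thesis by (simp add: inner_add_left)
qed

lemma mirror_step_three_point:
  assumes "is_arg_min (\<lambda>u. e * (g \<bullet> u) + D u z') (\<lambda>u. u \<in> X) z" and "u \<in> X"
  shows "e * (g \<bullet> (z - u)) \<le> D u z' - D u z - D z z'"
  using mirror_step_optimality[OF assms]
  by (simp add: bregman_def algebra_simps)

text \<open>Strong convexity makes the minimizer a Lipschitz function of the linear term. The set of
  linear terms for which a minimizer exists need not be Borel; passing to the continuous extension
  to its closure gives a Borel function.\<close>

lemma mirror_step_measurable:
  "\<exists>Q\<in>borel_measurable borel. \<forall>e g z' z.
     is_arg_min (\<lambda>u. e * (g \<bullet> u) + D u z') (\<lambda>u. u \<in> X) z \<longrightarrow> z = Q (e *\<^sub>R g - grad_\<psi> z')"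
proof -
  define R where "R v z \<longleftrightarrow> z \<in> X \<and> (\<forall>u\<in>X. 0 \<le> (v + grad_\<psi> z) \<bullet> (u - z))" for v z
  define A where "A = {v. \<exists>z. R v z}"
  define q where "q v = (SOME z. R v z)" for v
  obtain m where m: "0 < m" "\<And>x. m * norm x \<le> N x" using norm_equivalent by metis
  have lip: "m\<^sup>2 * norm (z - z') \<le> norm (v - v')" if "R v z" "R v' z'" for v v' z z'
  proof -
    have "z \<in> X" "z' \<in> X" using that by (auto simp: R_def)
    have "(m * norm (z - z'))\<^sup>2 \<le> (N (z - z'))\<^sup>2"
      using m by (intro power_mono) auto
    also have "\<dots> \<le> D z z' + D z' z"
      using bregman_lower[of z z'] bregman_lower[of z' z] \<open>z \<in> X\<close> \<open>z' \<in> X\<close> norm_diff_commute[of z z']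
      by simp
    also have "\<dots> \<le> (v - v') \<bullet> (z' - z)"
    proof -
      have "0 \<le> (v + grad_\<psi> z) \<bullet> (z' - z)" "0 \<le> (v' + grad_\<psi> z') \<bullet> (z - z')"
        using that by (auto simp: R_def)
      then show ?thesis
        by (simp add: bregman_def algebra_simps)
    qed
    also have "\<dots> \<le> norm (v - v') * norm (z - z')"
      using norm_cauchy_schwarz[of "v - v'" "z' - z"] by (simp add: norm_minus_commute)
    finally show ?thesis
      by (cases "z = z'") (auto simp: power2_eq_square algebra_simps)
  qed
  have q: "R v (q v)" if "v \<in> A" for v
    using that unfolding A_def q_def by (auto intro: someI)
  have uniq: "z = q v" if "R v z" for v z
  proof -
    have "v \<in> A" using that by (auto simp: A_def)
    then have "m\<^sup>2 * norm (z - q v) \<le> 0" using lip[OF that q[OF \<open>v \<in> A\<close>]] by simp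
    then show ?thesis using m(1) by (simp add: mult_le_0_iff)
  qed
  have "uniformly_continuous_on A q"
    unfolding uniformly_continuous_on_def
  proof (intro allI impI)
    fix \<epsilon> :: real assume "0 < \<epsilon>"
    have "dist (q v') (q v) < \<epsilon>" if "v \<in> A" "v' \<in> A" "dist v' v < m\<^sup>2 * \<epsilon>" for v v'
    proof -
      have "m\<^sup>2 * dist (q v') (q v) < m\<^sup>2 * \<epsilon>"
        using lip[OF q[OF that(2)] q[OF that(1)]] that(3) by (simp add: dist_norm)
      then show ?thesis using m(1) by simp
    qed
    then show "\<exists>d>0. \<forall>v\<in>A. \<forall>v'\<in>A. dist v' v < d \<longrightarrow> dist (q v') (q v) < \<epsilon>"
      using m(1) \<open>0 < \<epsilon>\<close> by (intro exI[of _ "m\<^sup>2 * \<epsilon>"]) auto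
  qed
  then obtain Q where Q: "uniformly_continuous_on (closure A) Q" "\<And>v. v \<in> A \<Longrightarrow> q v = Q v"
    using uniformly_continuous_on_extension_on_closure by metis
  define P where "P v = indicator (closure A) v *\<^sub>R Q v" for v
  have P: "P \<in> borel_measurable borel"
    unfolding P_def using uniformly_continuous_imp_continuous[OF Q(1)]
    by (intro borel_measurable_continuous_on_indicator) auto
  have "z = P (e *\<^sub>R g - grad_\<psi> z')"
    if min: "is_arg_min (\<lambda>u. e * (g \<bullet> u) + D u z') (\<lambda>u. u \<in> X) z" for e g z' z
  proof -
    have "R (e *\<^sub>R g - grad_\<psi> z') z"
      using mirror_step_optimality[OF min] min unfolding R_def by (auto simp: is_arg_min_def)
    then show ?thesis
      using uniq[of "e *\<^sub>R g - grad_\<psi> z'" z] Q(2)[of "e *\<^sub>R g - grad_\<psi> z'"] closure_subset[of A]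
      by (auto simp: A_def P_def indicator_def)
  qed
  then show ?thesis using P by blast
qed

end

section \<open>An exponential supermartingale\<close>

lemma exp_le_add_exp_square: "exp (s::real) \<le> s + exp (s\<^sup>2)"
proof -
  have sq: "1 + s\<^sup>2 \<le> exp (s\<^sup>2)" by (rule exp_ge_add_one_self)
  consider "1 < s" | "0 \<le> s" "s \<le> 1" | "-1 \<le> s" "s \<le> 0" | "s < -1" by linarith
  then show ?thesis
  proof cases
    case 1
    then have "exp s \<le> exp (s\<^sup>2)" by (simp add: power2_eq_square)
    then show ?thesis using 1 by linarith
  next
    case 2
    then show ?thesis using exp_bound[of s] sq by linarith
  next
    case 3
    have "exp s * (1 - s) \<le> exp s * exp (- s)"
      using exp_ge_add_one_self[of "- s"] by (intro mult_left_mono) auto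
    also have "\<dots> = 1" by (simp flip: exp_add)
    also have "1 \<le> (1 + s + s\<^sup>2) * (1 - s)"
      using 3 mult_nonneg_nonneg[of "- s" "s\<^sup>2"] by (simp add: algebra_simps power2_eq_square)
    finally have "exp s \<le> 1 + s + s\<^sup>2" using 3 by simp
    then show ?thesis using sq by linarith
  next
    case 4
    then have "- s \<le> s\<^sup>2" using mult_nonneg_nonneg[of "- s" "- s - 1"] by (simp add: power2_eq_square algebra_simps)
    moreover have "exp s \<le> 1" using 4 by simp
    ultimately show ?thesis using sq by linarith
  qed
qed

lemma le_exp_square: "(s::real) \<le> exp (s\<^sup>2)"
proof -
  have "2 * s \<le> 1 + s\<^sup>2" using zero_le_power2[of "s - 1"] by (simp add: power2_diff)
  moreover have "0 \<le> s\<^sup>2" by simp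
  ultimately have "s \<le> 1 + s\<^sup>2" by linarith
  then show ?thesis using exp_ge_add_one_self[of "s\<^sup>2"] by linarith
qed

text \<open>The linear term has to survive without a random factor, since only then does it vanish in
  conditional expectation; the factor \<open>2\<close> in front of \<open>q\<close> pays for that.\<close>

lemma exp_add_le:
  fixes s q :: real
  assumes "0 \<le> q"
  shows "exp (s + q) \<le> s + exp (s\<^sup>2 + 2 * q)"
proof -
  have q1: "1 \<le> exp q" using assms by simp
  have "1 * exp (s\<^sup>2) \<le> exp q * exp (s\<^sup>2)" using q1 by (intro mult_right_mono) auto
  then have "s \<le> exp q * exp (s\<^sup>2)"
    using le_exp_square[of s] by linarith
  then have "(exp q - 1) * s \<le> (exp q - 1) * (exp q * exp (s\<^sup>2))"
    using q1 by (intro mult_left_mono) auto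
  moreover have "exp q * exp s \<le> exp q * (s + exp (s\<^sup>2))"
    by (intro mult_left_mono exp_le_add_exp_square) auto
  ultimately have "exp q * exp s \<le> s + exp q * exp q * exp (s\<^sup>2)"
    unfolding left_diff_distrib distrib_left by (simp add: mult.assoc)
  moreover have "exp (s\<^sup>2 + 2 * q) = exp q * exp q * exp (s\<^sup>2)" "exp (s + q) = exp q * exp s"
    unfolding exp_add[symmetric] by (simp_all add: add.commute)
  ultimately show ?thesis by simp
qed

lemma exp_interpolate:
  fixes p k :: real
  assumes "0 \<le> p" "p \<le> 1"
  shows "exp (p * k) \<le> exp p * ((1 - p) + p * exp (k - 1))"
proof -
  have "exp ((1 - p) *\<^sub>R 0 + p *\<^sub>R (k - 1)) \<le> (1 - p) * exp 0 + p * exp (k - 1)"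
    using assms exp_convex by (intro convex_onD) auto
  then have "exp p * exp (p * (k - 1)) \<le> exp p * ((1 - p) + p * exp (k - 1))"
    by (intro mult_left_mono) auto
  then show ?thesis by (simp add: algebra_simps flip: exp_add)
qed

text \<open>The exponent that is spent on the noise: \<open>a\<close> stands for the norm of the predictable
  direction. For small \<open>a\<close> the linear term is kept, to be cancelled by centering. For large
  \<open>a\<close> already \<open>s \<le> (a \<sigma>)\<^sup>2 + Y\<^sup>2 / (4 \<sigma>\<^sup>2)\<close> is good enough, because then \<open>1 / 4\<close> is at most
  \<open>(a \<sigma>)\<^sup>2\<close>.\<close>

definition noise_exponent :: "real \<Rightarrow> real \<Rightarrow> real \<Rightarrow> real" where
  "noise_exponent \<sigma> b a = (if a\<^sup>2 * \<sigma>\<^sup>2 \<le> 2 / 3 then (a\<^sup>2 + 2 * b) * \<sigma>\<^sup>2 else 1 / 4 + b * \<sigma>\<^sup>2)"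

lemma noise_exponent_bounds:
  assumes "0 \<le> b" "6 * b * \<sigma>\<^sup>2 \<le> 1"
  shows "0 \<le> noise_exponent \<sigma> b a" "noise_exponent \<sigma> b a \<le> 1"
  using assms by (auto simp: noise_exponent_def algebra_simps)

lemma exp_noise_le:
  fixes a b s Y \<sigma> :: real
  assumes s: "\<bar>s\<bar> \<le> Y * a" and "0 \<le> b" "6 * b * \<sigma>\<^sup>2 \<le> 1" "0 < \<sigma>"
  defines "p \<equiv> noise_exponent \<sigma> b a"
  shows "exp (s + b * Y\<^sup>2)
    \<le> (if a\<^sup>2 * \<sigma>\<^sup>2 \<le> 2 / 3 then s else 0)
      + exp (2 * \<sigma>\<^sup>2 * (a\<^sup>2 + b)) * ((1 - p) + p * exp (Y\<^sup>2 / \<sigma>\<^sup>2 - 1))"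
proof -
  define k where "k = Y\<^sup>2 / \<sigma>\<^sup>2"
  define J where "J = (1 - p) + p * exp (k - 1)"
  have p: "0 \<le> p" "p \<le> 1" unfolding p_def using noise_exponent_bounds assms by auto
  have J: "0 \<le> J" unfolding J_def using p by (intro add_nonneg_nonneg mult_nonneg_nonneg) auto
  have bound: "exp (r + p * k) \<le> exp (2 * \<sigma>\<^sup>2 * (a\<^sup>2 + b)) * J"
    if "r + p \<le> 2 * \<sigma>\<^sup>2 * (a\<^sup>2 + b)" for r
  proof -
    have "exp (r + p * k) \<le> exp r * (exp p * J)"
      unfolding exp_add J_def using exp_interpolate[OF p] by (intro mult_left_mono) auto
    also have "\<dots> = exp (r + p) * J" by (simp add: exp_add)
    also have "\<dots> \<le> exp (2 * \<sigma>\<^sup>2 * (a\<^sup>2 + b)) * J" using that J by (intro mult_right_mono) auto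
    finally show ?thesis .
  qed
  have Yk: "Y\<^sup>2 = \<sigma>\<^sup>2 * k" using assms by (simp add: k_def)
  show ?thesis
  proof (cases "a\<^sup>2 * \<sigma>\<^sup>2 \<le> 2 / 3")
    case True
    have "s\<^sup>2 \<le> (Y * a)\<^sup>2" using s by (metis abs_ge_zero power2_abs power_mono)
    then have "s\<^sup>2 + 2 * (b * Y\<^sup>2) \<le> p * k"
      using True by (simp add: p_def noise_exponent_def Yk power_mult_distrib algebra_simps)
    then have "s + exp (s\<^sup>2 + 2 * (b * Y\<^sup>2)) \<le> s + exp (0 + p * k)" by simp
    moreover have "exp (s + b * Y\<^sup>2) \<le> s + exp (s\<^sup>2 + 2 * (b * Y\<^sup>2))"
      using \<open>0 \<le> b\<close> by (intro exp_add_le) simp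
    ultimately have "exp (s + b * Y\<^sup>2) \<le> s + exp (0 + p * k)" by linarith
    also have "exp (0 + p * k) \<le> exp (2 * \<sigma>\<^sup>2 * (a\<^sup>2 + b)) * J"
      using True by (intro bound) (simp add: p_def noise_exponent_def algebra_simps)
    finally show ?thesis using True by (simp add: J_def k_def)
  next
    case False
    have "0 \<le> (a * \<sigma> - Y / (2 * \<sigma>))\<^sup>2" by simp
    then have "Y * a \<le> a\<^sup>2 * \<sigma>\<^sup>2 + 1 / 4 * k"
      using \<open>0 < \<sigma>\<close> by (simp add: k_def power2_eq_square field_simps)
    then have "s + b * Y\<^sup>2 \<le> a\<^sup>2 * \<sigma>\<^sup>2 + p * k"
      using False s by (simp add: p_def noise_exponent_def Yk algebra_simps)
    then have "exp (s + b * Y\<^sup>2) \<le> exp (a\<^sup>2 * \<sigma>\<^sup>2 + p * k)" by simp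
    also have "\<dots> \<le> exp (2 * \<sigma>\<^sup>2 * (a\<^sup>2 + b)) * J"
    proof (rule bound)
      have "0 \<le> b * \<sigma>\<^sup>2" using \<open>0 \<le> b\<close> by simp
      then show "a\<^sup>2 * \<sigma>\<^sup>2 + p \<le> 2 * \<sigma>\<^sup>2 * (a\<^sup>2 + b)"
        using False by (simp add: p_def noise_exponent_def algebra_simps)
    qed
    finally show ?thesis using False by (simp add: J_def k_def)
  qed
qed

text \<open>Conditional centering of a random vector, tested against a predictable random vector instead
  of along the fixed basis.\<close>

lemma cond_mean_zero_inner:
  fixes Z v :: "'w \<Rightarrow> 'a::euclidean_space"
  assumes "prob_space M" "subalgebra M F" and mean: "cond_mean_zero M F Z"
    and v: "v \<in> borel_measurable F"
    and int: "integrable M (\<lambda>\<omega>. norm (v \<omega>) * norm (Z \<omega>))"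
  shows "integrable M (\<lambda>\<omega>. Z \<omega> \<bullet> v \<omega>)" "(\<integral>\<omega>. Z \<omega> \<bullet> v \<omega> \<partial>M) = 0"
proof -
  interpret prob_space M by fact
  interpret finite_measure_subalgebra M F by unfold_locales fact
  have [measurable]: "Z \<in> borel_measurable M" "v \<in> borel_measurable M"
    using mean v measurable_from_subalg[OF \<open>subalgebra M F\<close>] by (auto simp: cond_mean_zero_def)
  have int_b: "integrable M (\<lambda>\<omega>. (v \<omega> \<bullet> b) * (Z \<omega> \<bullet> b))" if "b \<in> Basis" for b
    by (rule Bochner_Integration.integrable_bound[OF int])
      (use that in \<open>auto simp: abs_mult intro!: mult_mono Basis_le_norm\<close>)
  have "(\<integral>\<omega>. (v \<omega> \<bullet> b) * (Z \<omega> \<bullet> b) \<partial>M) = 0" if b: "b \<in> Basis" for b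
  proof -
    have "(\<integral>\<omega>. (v \<omega> \<bullet> b) * (Z \<omega> \<bullet> b) \<partial>M)
        = (\<integral>\<omega>. (v \<omega> \<bullet> b) * real_cond_exp M F (\<lambda>\<omega>. Z \<omega> \<bullet> b) \<omega> \<partial>M)"
      using v by (intro real_cond_exp_intg(2)[symmetric] int_b b) auto
    also have "\<dots> = (\<integral>\<omega>. 0 \<partial>M)"
      using mean b unfolding cond_mean_zero_def by (intro integral_cong_AE) auto
    finally show ?thesis by simp
  qed
  moreover have "Z \<omega> \<bullet> v \<omega> = (\<Sum>b\<in>Basis. (v \<omega> \<bullet> b) * (Z \<omega> \<bullet> b))" for \<omega>
    by (subst euclidean_inner) (simp add: mult.commute)
  ultimately show "integrable M (\<lambda>\<omega>. Z \<omega> \<bullet> v \<omega>)" "(\<integral>\<omega>. Z \<omega> \<bullet> v \<omega> \<partial>M) = 0"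
    using int_b by auto
qed

context general_norm
begin

text \<open>The last term compensates the conditional exponential moment of the first two, where \<open>u\<close> is a
  predictable direction and \<open>v\<close> the noise.\<close>

definition noise_increment :: "real \<Rightarrow> real \<Rightarrow> 'a \<Rightarrow> 'a \<Rightarrow> real" where
  "noise_increment \<sigma> b u v = v \<bullet> u + b * (dual_norm N v)\<^sup>2 - 2 * \<sigma>\<^sup>2 * ((N u)\<^sup>2 + b)"

lemma noise_increment_measurable:
  assumes "u \<in> borel_measurable F" "v \<in> borel_measurable F"
  shows "(\<lambda>\<omega>. noise_increment \<sigma> b (u \<omega>) (v \<omega>)) \<in> borel_measurable F"
  unfolding noise_increment_def using assms by measurable

lemma nn_integral_exp_dual_norm_le:
  assumes "prob_space M" "subalgebra M F" and \<sigma>: "0 < \<sigma>"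
    and Z: "Z \<in> borel_measurable M"
    and sub: "cond_subgaussian M F \<sigma> (\<lambda>\<omega>. dual_norm N (Z \<omega>))"
    and h: "h \<in> borel_measurable F"
  shows "(\<integral>\<^sup>+\<omega>. h \<omega> * ennreal (exp ((dual_norm N (Z \<omega>))\<^sup>2 / \<sigma>\<^sup>2)) \<partial>M)
    \<le> (\<integral>\<^sup>+\<omega>. h \<omega> * ennreal (exp 1) \<partial>M)"
proof -
  interpret prob_space M by fact
  interpret finite_measure_subalgebra M F by unfold_locales fact
  note [measurable] = Z
  let ?W = "\<lambda>\<omega>. ennreal (exp ((dual_norm N (Z \<omega>))\<^sup>2 / \<sigma>\<^sup>2))"
  have "AE \<omega> in M. nn_cond_exp M F ?W \<omega> \<le> ennreal (exp 1)"
    using sub[unfolded cond_subgaussian_def, rule_format, of "1 / \<sigma>"] \<sigma> by (simp add: power_divide)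
  then have "(\<integral>\<^sup>+\<omega>. h \<omega> * nn_cond_exp M F ?W \<omega> \<partial>M) \<le> (\<integral>\<^sup>+\<omega>. h \<omega> * ennreal (exp 1) \<partial>M)"
    by (intro nn_integral_mono_AE) (auto elim!: eventually_mono intro: mult_left_mono)
  then show ?thesis by (subst (asm) nn_cond_exp_intg) (use h in measurable)
qed

text \<open>One step of the supermartingale. After \<open>exp_noise_le\<close> the integrand is a predictable multiple
  of the centered noise plus a predictable convex combination of \<open>1\<close> and
  \<open>exp (\<parallel>Z\<parallel>\<^sub>*\<^sup>2 / \<sigma>\<^sup>2 - 1)\<close>, whose conditional means are \<open>0\<close> and at most \<open>1\<close>. The sub-Gaussian
  condition is stated for constant parameters while the exponent here is random; interpolating
  from the constant parameter \<open>1 / \<sigma>\<close> bridges the gap.\<close>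

lemma nn_integral_noise_increment_le:
  assumes "prob_space M" "subalgebra M F" and \<sigma>: "0 < \<sigma>"
    and mean: "cond_mean_zero M F Z"
    and sub: "cond_subgaussian M F \<sigma> (\<lambda>\<omega>. dual_norm N (Z \<omega>))"
    and u: "u \<in> borel_measurable F"
    and b: "0 \<le> b" "6 * b * \<sigma>\<^sup>2 \<le> 1"
    and H: "H \<in> borel_measurable F" "\<And>\<omega>. 0 \<le> H \<omega>"
  shows "(\<integral>\<^sup>+\<omega>. ennreal (H \<omega> * exp (noise_increment \<sigma> b (u \<omega>) (Z \<omega>))) \<partial>M) \<le> (\<integral>\<^sup>+\<omega>. ennreal (H \<omega>) \<partial>M)"
proof (cases "(\<integral>\<^sup>+\<omega>. ennreal (H \<omega>) \<partial>M) = \<infinity>")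
  case False
  interpret prob_space M by fact
  interpret finite_measure_subalgebra M F by unfold_locales fact
  have Z: "Z \<in> borel_measurable M" using mean by (auto simp: cond_mean_zero_def)
  note [measurable] = Z
  note from_F = measurable_from_subalg[OF \<open>subalgebra M F\<close>]
  have [measurable]: "u \<in> borel_measurable M" "H \<in> borel_measurable M"
    using u H by (auto intro: from_F)
  note noise_bound = nn_integral_exp_dual_norm_le[OF assms(1,2) \<sigma> Z sub]
  define Y where "Y \<omega> = dual_norm N (Z \<omega>)" for \<omega>
  define a where "a \<omega> = N (u \<omega>)" for \<omega>
  define W where "W \<omega> = exp ((Y \<omega>)\<^sup>2 / \<sigma>\<^sup>2)" for \<omega>
  define p where "p \<omega> = noise_exponent \<sigma> b (a \<omega>)" for \<omega>
  define c where "c \<omega> = (if (a \<omega>)\<^sup>2 * \<sigma>\<^sup>2 \<le> 2 / 3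
    then H \<omega> * exp (- (2 * \<sigma>\<^sup>2 * ((a \<omega>)\<^sup>2 + b))) else 0)" for \<omega>
  have aF [measurable]: "a \<in> borel_measurable F" unfolding a_def using u by measurable
  have pF [measurable]: "p \<in> borel_measurable F"
    unfolding p_def noise_exponent_def by measurable
  have cF [measurable]: "c \<in> borel_measurable F" unfolding c_def using H(1) by measurable
  have [measurable]: "Y \<in> borel_measurable M" "W \<in> borel_measurable M" "p \<in> borel_measurable M"
    "c \<in> borel_measurable M"
    unfolding Y_def W_def by (auto intro: from_F)
  have p: "0 \<le> p \<omega>" "p \<omega> \<le> 1" for \<omega> unfolding p_def using noise_exponent_bounds[OF b] by auto
  have Y0: "0 \<le> Y \<omega>" and a0: "0 \<le> a \<omega>" for \<omega>
    by (auto simp: Y_def a_def dual_norm_nonneg norm_nonneg)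

  have pointwise: "H \<omega> * exp (noise_increment \<sigma> b (u \<omega>) (Z \<omega>))
      \<le> Z \<omega> \<bullet> (c \<omega> *\<^sub>R u \<omega>) + (H \<omega> * (1 - p \<omega>) + H \<omega> * p \<omega> / exp 1 * W \<omega>)" for \<omega>
  proof -
    define R where "R = 2 * \<sigma>\<^sup>2 * ((a \<omega>)\<^sup>2 + b)"
    define J where "J = (1 - p \<omega>) + p \<omega> * exp ((Y \<omega>)\<^sup>2 / \<sigma>\<^sup>2 - 1)"
    have "exp (Z \<omega> \<bullet> u \<omega> + b * (Y \<omega>)\<^sup>2)
        \<le> (if (a \<omega>)\<^sup>2 * \<sigma>\<^sup>2 \<le> 2 / 3 then Z \<omega> \<bullet> u \<omega> else 0) + exp R * J"
      unfolding p_def R_def J_def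
      by (rule exp_noise_le) (use b \<sigma> in \<open>auto simp: Y_def a_def abs_inner_le_dual_norm\<close>)
    then have "(H \<omega> * exp (- R)) * exp (Z \<omega> \<bullet> u \<omega> + b * (Y \<omega>)\<^sup>2)
        \<le> (H \<omega> * exp (- R)) * ((if (a \<omega>)\<^sup>2 * \<sigma>\<^sup>2 \<le> 2 / 3 then Z \<omega> \<bullet> u \<omega> else 0) + exp R * J)"
      using H(2) by (intro mult_left_mono) auto
    also have "\<dots> = Z \<omega> \<bullet> (c \<omega> *\<^sub>R u \<omega>) + H \<omega> * (exp (- R) * exp R) * J"
      by (simp add: c_def R_def algebra_simps)
    also have "exp (- R) * exp R = 1" by (simp flip: exp_add)
    also have "H \<omega> * 1 * J = H \<omega> * (1 - p \<omega>) + H \<omega> * p \<omega> / exp 1 * W \<omega>"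
      by (simp add: J_def W_def exp_diff algebra_simps)
    also have "(H \<omega> * exp (- R)) * exp (Z \<omega> \<bullet> u \<omega> + b * (Y \<omega>)\<^sup>2)
        = H \<omega> * exp (noise_increment \<sigma> b (u \<omega>) (Z \<omega>))"
      unfolding mult.assoc exp_add[symmetric]
      by (simp add: noise_increment_def R_def Y_def a_def)
    finally show ?thesis .
  qed

  have int_H: "integrable M H"
    using False H(2) by (intro integrableI_nonneg) (auto simp: top.not_eq_extremum)
  have int_HW: "integrable M (\<lambda>\<omega>. H \<omega> * W \<omega>)"
  proof (rule integrableI_nonneg)
    have "(\<integral>\<^sup>+\<omega>. ennreal (H \<omega> * W \<omega>) \<partial>M) = (\<integral>\<^sup>+\<omega>. ennreal (H \<omega>) * ennreal (W \<omega>) \<partial>M)"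
      using H(2) by (simp add: ennreal_mult W_def)
    also have "\<dots> \<le> (\<integral>\<^sup>+\<omega>. ennreal (H \<omega>) * ennreal (exp 1) \<partial>M)"
      unfolding W_def Y_def using H(1) by (intro noise_bound) auto
    also have "\<dots> = (\<integral>\<^sup>+\<omega>. ennreal (H \<omega>) \<partial>M) * ennreal (exp 1)" by (rule nn_integral_multc) auto
    also have "\<dots> < \<infinity>" using False by (simp add: ennreal_mult_less_top top.not_eq_extremum)
    finally show "(\<integral>\<^sup>+\<omega>. ennreal (H \<omega> * W \<omega>) \<partial>M) < \<infinity>" .
  qed (auto simp: W_def H(2))

  \<comment> \<open>The direction is small where \<open>c\<close> is nonzero, so that \<open>H\<close> times \<open>W\<close> dominates the linear
    term although \<open>H\<close> is unbounded.\<close>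
  obtain m where m: "0 < m" "\<And>x. m * norm x \<le> N x" using norm_equivalent by metis
  obtain K where K: "0 < K" "\<And>v. norm v \<le> K * dual_norm N v" using norm_le_dual_norm by metis
  have int_norms: "integrable M (\<lambda>\<omega>. norm (c \<omega> *\<^sub>R u \<omega>) * norm (Z \<omega>))"
  proof (rule Bochner_Integration.integrable_bound)
    show "integrable M (\<lambda>\<omega>. K / m * (H \<omega> * W \<omega>))" using int_HW by simp
    show "AE \<omega> in M. norm (norm (c \<omega> *\<^sub>R u \<omega>) * norm (Z \<omega>)) \<le> norm (K / m * (H \<omega> * W \<omega>))"
    proof (rule AE_I2)
      fix \<omega>
      show "norm (norm (c \<omega> *\<^sub>R u \<omega>) * norm (Z \<omega>)) \<le> norm (K / m * (H \<omega> * W \<omega>))"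
      proof (cases "(a \<omega>)\<^sup>2 * \<sigma>\<^sup>2 \<le> 2 / 3")
        case True
        have "0 \<le> 2 * \<sigma>\<^sup>2 * ((a \<omega>)\<^sup>2 + b)" using b(1) by simp
        then have cH: "0 \<le> c \<omega>" "c \<omega> \<le> H \<omega>"
          using True H(2)[of \<omega>] by (auto simp: c_def mult_left_le)
        have "(a \<omega> * \<sigma>)\<^sup>2 \<le> 1\<^sup>2" using True by (simp add: power_mult_distrib)
        then have "a \<omega> * \<sigma> \<le> 1" by (rule power2_le_imp_le) simp
        then have "a \<omega> * Y \<omega> \<le> Y \<omega> / \<sigma>"
          using \<sigma> Y0[of \<omega>] mult_right_mono[of "a \<omega> * \<sigma>" 1 "Y \<omega>"] by (simp add: field_simps)
        also have "\<dots> \<le> W \<omega>"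
          using le_exp_square[of "Y \<omega> / \<sigma>"] by (simp add: W_def power_divide)
        finally have aY: "a \<omega> * Y \<omega> \<le> W \<omega>" .
        have "norm (u \<omega>) \<le> a \<omega> / m" using m(2)[of "u \<omega>"] m(1) by (simp add: a_def field_simps)
        then have "norm (u \<omega>) * norm (Z \<omega>) \<le> a \<omega> / m * (K * Y \<omega>)"
          using K(2)[of "Z \<omega>"] a0[of \<omega>] m(1) by (intro mult_mono) (auto simp: Y_def)
        also have "\<dots> = K / m * (a \<omega> * Y \<omega>)" by simp
        also have "\<dots> \<le> K / m * W \<omega>" using aY K(1) m(1) by (intro mult_left_mono) auto
        finally have "c \<omega> * (norm (u \<omega>) * norm (Z \<omega>)) \<le> H \<omega> * (K / m * W \<omega>)"
          using cH H(2)[of \<omega>] by - (rule mult_mono; simp)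
        then show ?thesis
          using cH H(2)[of \<omega>] K(1) m(1) by (simp add: W_def abs_mult ac_simps)
      qed (simp add: c_def)
    qed
  qed measurable
  have "(\<lambda>\<omega>. c \<omega> *\<^sub>R u \<omega>) \<in> borel_measurable F" using cF u by (rule borel_measurable_scaleR)
  note lin = cond_mean_zero_inner[OF assms(1,2) mean this int_norms]

  define B where "B \<omega> = H \<omega> * (1 - p \<omega>) + H \<omega> * p \<omega> / exp 1 * W \<omega>" for \<omega>
  have B0: "0 \<le> B \<omega>" for \<omega>
    unfolding B_def W_def using p H(2) by (intro add_nonneg_nonneg mult_nonneg_nonneg) auto
  have B_le: "(\<integral>\<^sup>+\<omega>. ennreal (B \<omega>) \<partial>M) \<le> (\<integral>\<^sup>+\<omega>. ennreal (H \<omega>) \<partial>M)"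
  proof -
    have coeff: "(\<lambda>\<omega>. ennreal (H \<omega> * p \<omega> / exp 1)) \<in> borel_measurable F"
      using H(1) pF by measurable
    have nonneg: "0 \<le> H \<omega> * (1 - p \<omega>)" "0 \<le> H \<omega> * p \<omega> / exp 1" "0 \<le> W \<omega>" for \<omega>
      using p H(2) by (simp_all add: W_def)
    have "(\<integral>\<^sup>+\<omega>. ennreal (B \<omega>) \<partial>M)
        = (\<integral>\<^sup>+\<omega>. ennreal (H \<omega> * (1 - p \<omega>)) + ennreal (H \<omega> * p \<omega> / exp 1) * ennreal (W \<omega>) \<partial>M)"
      unfolding B_def ennreal_mult[OF nonneg(2,3), symmetric]
        ennreal_plus[OF nonneg(1) mult_nonneg_nonneg[OF nonneg(2,3)], symmetric] by (rule refl)
    also have "\<dots> = (\<integral>\<^sup>+\<omega>. ennreal (H \<omega> * (1 - p \<omega>)) \<partial>M)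
        + (\<integral>\<^sup>+\<omega>. ennreal (H \<omega> * p \<omega> / exp 1) * ennreal (W \<omega>) \<partial>M)"
      by (rule nn_integral_add) auto
    also have "\<dots> \<le> (\<integral>\<^sup>+\<omega>. ennreal (H \<omega> * (1 - p \<omega>)) \<partial>M)
        + (\<integral>\<^sup>+\<omega>. ennreal (H \<omega> * p \<omega> / exp 1) * ennreal (exp 1) \<partial>M)"
      unfolding W_def Y_def by (rule add_left_mono, rule noise_bound, rule coeff)
    also have "\<dots> = (\<integral>\<^sup>+\<omega>. ennreal (H \<omega> * (1 - p \<omega>))
        + ennreal (H \<omega> * p \<omega> / exp 1) * ennreal (exp 1) \<partial>M)"
      by (rule nn_integral_add[symmetric]) auto
    also have "\<dots> = (\<integral>\<^sup>+\<omega>. ennreal (H \<omega>) \<partial>M)"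
    proof (rule nn_integral_cong)
      fix \<omega>
      have "ennreal (H \<omega> * (1 - p \<omega>)) + ennreal (H \<omega> * p \<omega> / exp 1) * ennreal (exp 1)
          = ennreal (H \<omega> * (1 - p \<omega>) + H \<omega> * p \<omega> / exp 1 * exp 1)"
        unfolding ennreal_mult[OF nonneg(2) exp_ge_zero, symmetric]
          ennreal_plus[OF nonneg(1) mult_nonneg_nonneg[OF nonneg(2) exp_ge_zero], symmetric]
        by (rule refl)
      also have "H \<omega> * (1 - p \<omega>) + H \<omega> * p \<omega> / exp 1 * exp 1 = H \<omega>" by (simp add: algebra_simps)
      finally show "ennreal (H \<omega> * (1 - p \<omega>)) + ennreal (H \<omega> * p \<omega> / exp 1) * ennreal (exp 1)
          = ennreal (H \<omega>)" .
    qed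
    finally show ?thesis .
  qed
  have "(\<integral>\<^sup>+\<omega>. ennreal (B \<omega>) \<partial>M) < \<infinity>"
    using B_le False by (auto simp: top.not_eq_extremum intro: le_less_trans)
  moreover have "B \<in> borel_measurable M" unfolding B_def by measurable
  ultimately have int_B: "integrable M B" using B0 by (intro integrableI_nonneg) auto
  let ?E = "\<lambda>\<omega>. Z \<omega> \<bullet> (c \<omega> *\<^sub>R u \<omega>) + B \<omega>"
  have E0: "0 \<le> ?E \<omega>" for \<omega>
    using pointwise[of \<omega>] H(2)[of \<omega>] unfolding B_def
    by (meson exp_ge_zero mult_nonneg_nonneg order_trans)
  have "(\<integral>\<^sup>+\<omega>. ennreal (H \<omega> * exp (noise_increment \<sigma> b (u \<omega>) (Z \<omega>))) \<partial>M) \<le> (\<integral>\<^sup>+\<omega>. ennreal (?E \<omega>) \<partial>M)"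
    using pointwise unfolding B_def by (intro nn_integral_mono ennreal_leI)
  also have "\<dots> = ennreal (\<integral>\<omega>. ?E \<omega> \<partial>M)"
    using lin(1) int_B E0 by (intro nn_integral_eq_integral) auto
  also have "(\<integral>\<omega>. ?E \<omega> \<partial>M) = (\<integral>\<omega>. B \<omega> \<partial>M)" using lin int_B by simp
  also have "ennreal \<dots> = (\<integral>\<^sup>+\<omega>. ennreal (B \<omega>) \<partial>M)"
    using int_B B0 by (intro nn_integral_eq_integral[symmetric]) auto
  also note B_le
  finally show ?thesis .
qed simp

text \<open>Markov's inequality for the supermartingale started at \<open>1\<close>.\<close>

lemma noise_concentration:
  fixes T :: nat
  assumes M: "prob_space M"
    and sub: "\<And>t. t \<in> {1..T} \<Longrightarrow> subalgebra M (F t)" and \<sigma>: "0 < \<sigma>" and \<delta>: "0 < \<delta>"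
    and mean: "\<And>t. t \<in> {1..T} \<Longrightarrow> cond_mean_zero M (F t) (Z t)"
    and subg: "\<And>t. t \<in> {1..T} \<Longrightarrow> cond_subgaussian M (F t) \<sigma> (\<lambda>\<omega>. dual_norm N (Z t \<omega>))"
    and adapted: "\<And>s t. s \<in> {1..<t} \<Longrightarrow> t \<le> T \<Longrightarrow> Z s \<in> borel_measurable (F t)"
    and predictable: "\<And>s t. s \<in> {1..t} \<Longrightarrow> t \<le> T \<Longrightarrow> u s \<in> borel_measurable (F t)"
    and b: "\<And>t. t \<in> {1..T} \<Longrightarrow> 0 \<le> b t" "\<And>t. t \<in> {1..T} \<Longrightarrow> 6 * b t * \<sigma>\<^sup>2 \<le> 1"
  defines "E \<equiv> (\<lambda>n \<omega>. \<Sum>t=1..n. noise_increment \<sigma> (b t) (u t \<omega>) (Z t \<omega>))"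
  shows "1 - \<delta> \<le> measure M {\<omega> \<in> space M. E T \<omega> \<le> ln (1 / \<delta>)}"
proof -
  interpret prob_space M by fact
  have exp_mean: "(\<integral>\<^sup>+\<omega>. ennreal (exp (E n \<omega>)) \<partial>M) \<le> 1" if "n \<le> T" for n
    using that
  proof (induction n)
    case 0
    then show ?case by (simp add: E_def emeasure_space_1)
  next
    case (Suc n)
    then have t: "Suc n \<in> {1..T}" by simp
    have Zs: "Z s \<in> borel_measurable (F (Suc n))" and us: "u s \<in> borel_measurable (F (Suc n))"
      if "s \<in> {1..n}" for s
      using adapted[of s "Suc n"] predictable[of s "Suc n"] that Suc.prems by auto
    have HF: "(\<lambda>\<omega>. exp (E n \<omega>)) \<in> borel_measurable (F (Suc n))"
      unfolding E_def using Zs us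
      by (intro borel_measurable_sum measurable_compose[OF _ borel_measurable_exp]
          noise_increment_measurable)
    have "(\<integral>\<^sup>+\<omega>. ennreal (exp (E (Suc n) \<omega>)) \<partial>M)
        = (\<integral>\<^sup>+\<omega>. ennreal (exp (E n \<omega>) * exp (noise_increment \<sigma> (b (Suc n)) (u (Suc n) \<omega>) (Z (Suc n) \<omega>))) \<partial>M)"
      by (simp add: E_def exp_add)
    also have "\<dots> \<le> (\<integral>\<^sup>+\<omega>. ennreal (exp (E n \<omega>)) \<partial>M)"
      using Suc.prems
      by (intro nn_integral_noise_increment_le[OF M sub[OF t] \<sigma> mean[OF t] subg[OF t] _ b[OF t] HF]
          predictable) auto
    also have "\<dots> \<le> 1" using Suc by simp
    finally show ?case .
  qed
  have [measurable]: "Z t \<in> borel_measurable M" "u t \<in> borel_measurable M" if "t \<in> {1..T}" for t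
    using mean[OF that] measurable_from_subalg[OF sub[OF that] predictable[of t t]] that
    by (auto simp: cond_mean_zero_def)
  have [measurable]: "E T \<in> borel_measurable M"
    unfolding E_def by (intro borel_measurable_sum noise_increment_measurable) auto
  define A where "A = {\<omega> \<in> space M. ln (1 / \<delta>) < E T \<omega>}"
  have A[measurable]: "A \<in> sets M" unfolding A_def by measurable
  have "emeasure M A = (\<integral>\<^sup>+\<omega>. indicator A \<omega> \<partial>M)" by simp
  also have "\<dots> \<le> (\<integral>\<^sup>+\<omega>. ennreal \<delta> * ennreal (exp (E T \<omega>)) \<partial>M)"
  proof (rule nn_integral_mono)
    fix \<omega>
    have "1 \<le> \<delta> * exp (E T \<omega>)" if "ln (1 / \<delta>) < E T \<omega>"
    proof -
      have "exp (ln (1 / \<delta>)) \<le> exp (E T \<omega>)" using that by simp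
      then show ?thesis using \<delta> by (simp add: field_simps)
    qed
    then show "indicator A \<omega> \<le> ennreal \<delta> * ennreal (exp (E T \<omega>))"
      using \<delta> by (auto simp: A_def indicator_def simp flip: ennreal_mult ennreal_1 intro!: ennreal_leI)
  qed
  also have "\<dots> = ennreal \<delta> * (\<integral>\<^sup>+\<omega>. ennreal (exp (E T \<omega>)) \<partial>M)" by (rule nn_integral_cmult) measurable
  also have "\<dots> \<le> ennreal \<delta> * 1" using exp_mean[of T] by (intro mult_left_mono) auto
  finally have "prob A \<le> \<delta>" using \<delta> by (simp add: emeasure_eq_measure)
  moreover have "{\<omega> \<in> space M. E T \<omega> \<le> ln (1 / \<delta>)} = space M - A" by (auto simp: A_def)
  ultimately show ?thesis using prob_compl[OF A] by simp
qed

end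

section \<open>The accelerated recursion along one path\<close>

locale composite_problem = mirror_map N X \<psi> grad_\<psi>
  for N :: "'a::euclidean_space \<Rightarrow> real" and X \<psi> grad_\<psi> +
  fixes f :: "'a \<Rightarrow> real" and grad_f :: "'a \<Rightarrow> 'a" and G L :: real and xstar x\<^sub>0 :: 'a
  assumes convex_f: "convex_on UNIV f"
    and grad_f: "GDERIV f u :> grad_f u"
    and GL: "0 \<le> G" "0 < L"
    and smooth: "u \<in> X \<Longrightarrow> v \<in> X \<Longrightarrow>
      f v \<le> f u + grad_f u \<bullet> (v - u) + G * N (v - u) + L / 2 * (N (v - u))\<^sup>2"
    and minimizer: "is_arg_min f (\<lambda>u. u \<in> X) xstar"
    and start: "x\<^sub>0 \<in> X"
begin

lemma xstar_in: "xstar \<in> X"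
  using minimizer by (simp add: is_arg_min_def)

lemma gap_nonneg: "u \<in> X \<Longrightarrow> 0 \<le> f u - f xstar"
  using minimizer by (auto simp: is_arg_min_def not_less)

text \<open>The stability of the mirror step contributes \<open>- N (z - z')\<^sup>2 / 2\<close>. Since \<open>\<eta> \<le> t / (4 L)\<close>, the
  smoothness term uses up at most half of it, and the other half absorbs the terms linear in
  \<open>N (z - z')\<close>, namely the Lipschitz part \<open>G\<close> and the noise evaluated at the new point.\<close>

lemma accelerated_step:
  fixes t :: nat and \<eta> :: real
  defines "\<alpha> \<equiv> 2 / (real t + 1)"
  assumes t: "1 \<le> t" and X: "x \<in> X" "y' \<in> X" "z' \<in> X" "y \<in> X"
    and x: "x = (1 - \<alpha>) *\<^sub>R y' + \<alpha> *\<^sub>R z'"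
    and y: "y = (1 - \<alpha>) *\<^sub>R y' + \<alpha> *\<^sub>R z"
    and z: "is_arg_min (\<lambda>u. \<eta> * (g \<bullet> u) + D u z') (\<lambda>u. u \<in> X) z"
    and \<eta>: "0 \<le> \<eta>" "\<eta> \<le> real t / (4 * L)"
  shows "(real t + 1) / 2 * \<eta> * (f y - f xstar) + D xstar z
    \<le> (real t - 1) / 2 * \<eta> * (f y' - f xstar) + D xstar z'
      + \<eta> * ((g - grad_f x) \<bullet> (xstar - z'))
      + 2 * \<eta>\<^sup>2 * (G\<^sup>2 + (dual_norm N (g - grad_f x))\<^sup>2)"
proof -
  have \<alpha>: "0 < \<alpha>" "\<alpha> \<le> 1" using t by (auto simp: \<alpha>_def)
  define d where "d = N (z - z')"
  define e where "e = dual_norm N (g - grad_f x)"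
  have zX: "z \<in> X" using z by (simp add: is_arg_min_def)
  have d0: "0 \<le> d" and e0: "0 \<le> e" by (simp_all add: d_def e_def norm_nonneg dual_norm_nonneg)
  have yx: "y - x = \<alpha> *\<^sub>R (z - z')" by (simp add: x y algebra_simps)
  have "f y \<le> f x + grad_f x \<bullet> (y - x) + G * (\<alpha> * d) + L / 2 * (\<alpha> * d)\<^sup>2"
    using smooth[OF X(1,4)] \<alpha>(1) by (simp add: yx norm_scale d_def)
  also have "f x + grad_f x \<bullet> (y - x)
      = (1 - \<alpha>) * (f x + grad_f x \<bullet> (y' - x)) + \<alpha> * (f x + grad_f x \<bullet> (xstar - x))
        + \<alpha> * (grad_f x \<bullet> (z - xstar))"
    by (simp add: y algebra_simps)
  also have "\<dots> \<le> (1 - \<alpha>) * f y' + \<alpha> * f xstar + \<alpha> * (grad_f x \<bullet> (z - xstar))"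
    using \<alpha> by (intro add_mono mult_left_mono convex_gradient_inequality convex_f grad_f) auto
  finally have descent: "f y - f xstar \<le> (1 - \<alpha>) * (f y' - f xstar)
      + \<alpha> * (grad_f x \<bullet> (z - xstar) + G * d + L * \<alpha> / 2 * d\<^sup>2)"
    by (simp add: algebra_simps power2_eq_square)
  have weights: "\<eta> / \<alpha> = (real t + 1) / 2 * \<eta>" "\<eta> / \<alpha> * (1 - \<alpha>) = (real t - 1) / 2 * \<eta>"
      "\<eta> / \<alpha> * \<alpha> = \<eta>"
    using t by (simp_all add: \<alpha>_def field_simps)
  have "\<eta> / \<alpha> * (f y - f xstar) \<le> \<eta> / \<alpha> * ((1 - \<alpha>) * (f y' - f xstar)
      + \<alpha> * (grad_f x \<bullet> (z - xstar) + G * d + L * \<alpha> / 2 * d\<^sup>2))"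
    using descent \<eta> \<alpha> by (intro mult_left_mono) auto
  also have "\<dots> = (\<eta> / \<alpha> * (1 - \<alpha>)) * (f y' - f xstar)
      + (\<eta> / \<alpha> * \<alpha>) * (grad_f x \<bullet> (z - xstar) + G * d + L * \<alpha> / 2 * d\<^sup>2)"
    by (simp only: distrib_left mult.assoc)
  finally have main: "(real t + 1) / 2 * \<eta> * (f y - f xstar)
      \<le> (real t - 1) / 2 * \<eta> * (f y' - f xstar)
        + \<eta> * (grad_f x \<bullet> (z - xstar) + G * d + L * \<alpha> / 2 * d\<^sup>2)"
    unfolding weights(2,3) unfolding weights(1) .
  have "\<eta> * (g \<bullet> (z - xstar)) \<le> D xstar z' - D xstar z - D z z'"
    by (rule mirror_step_three_point[OF z xstar_in])
  moreover have "d\<^sup>2 / 2 \<le> D z z'" using bregman_lower[OF zX X(3)] by (simp add: d_def)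
  ultimately have mirror: "\<eta> * (g \<bullet> (z - xstar)) \<le> D xstar z' - D xstar z - d\<^sup>2 / 2" by linarith
  have "(g - grad_f x) \<bullet> (z' - z) \<le> e * d"
    using inner_le_dual_norm[of "g - grad_f x" "z' - z"] norm_diff_commute[of z z']
    by (simp add: d_def e_def)
  then have "grad_f x \<bullet> (z - xstar)
      \<le> g \<bullet> (z - xstar) + (g - grad_f x) \<bullet> (xstar - z') + e * d"
    by (simp add: algebra_simps)
  then have split: "\<eta> * (grad_f x \<bullet> (z - xstar))
      \<le> \<eta> * (g \<bullet> (z - xstar)) + \<eta> * ((g - grad_f x) \<bullet> (xstar - z')) + \<eta> * (e * d)"
    using \<eta>(1) mult_left_mono[of _ _ \<eta>] by (simp flip: distrib_left)
  have smoothness: "\<eta> * (L * \<alpha> / 2 * d\<^sup>2) \<le> 1 / 4 * d\<^sup>2"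
  proof -
    have "\<eta> * (L * \<alpha> / 2) \<le> real t / (4 * L) * (L * \<alpha> / 2)"
      using \<eta> GL \<alpha> by (intro mult_right_mono) auto
    also have "\<dots> \<le> 1 / 4" using GL t by (simp add: \<alpha>_def field_simps)
    finally show ?thesis using mult_right_mono[of "\<eta> * (L * \<alpha> / 2)" "1 / 4" "d\<^sup>2"] by simp
  qed
  have young: "\<eta> * ((e + G) * d) - d\<^sup>2 / 4 \<le> 2 * \<eta>\<^sup>2 * (G\<^sup>2 + e\<^sup>2)"
  proof -
    have "\<eta> * ((e + G) * d) - d\<^sup>2 / 4 \<le> \<eta>\<^sup>2 * (e + G)\<^sup>2"
      using zero_le_power2[of "\<eta> * (e + G) - d / 2"]
      by (simp add: power2_eq_square algebra_simps)
    also have "\<dots> \<le> \<eta>\<^sup>2 * (2 * (G\<^sup>2 + e\<^sup>2))"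
      using zero_le_power2[of "e - G"]
      by (intro mult_left_mono) (auto simp: power2_eq_square algebra_simps)
    finally show ?thesis by (simp add: algebra_simps)
  qed
  have "\<eta> * ((e + G) * d) = \<eta> * (e * d) + \<eta> * (G * d)" by (simp add: distrib_left distrib_right)
  then show ?thesis
    using main mirror split smoothness young
    unfolding e_def[symmetric] distrib_left[of \<eta>] by linarith
qed

lemma run_step:
  fixes t :: nat
  assumes run: "asmd_path X \<psi> grad_\<psi> \<eta> T x\<^sub>0 g x y z" and t: "t \<in> {1..T}"
  defines "\<alpha> \<equiv> 2 / (real t + 1)"
  shows "x t = (1 - \<alpha>) *\<^sub>R y (t - 1) + \<alpha> *\<^sub>R z (t - 1)"
    "is_arg_min (\<lambda>u. \<eta> t * (g t \<bullet> u) + D u (z (t - 1))) (\<lambda>u. u \<in> X) (z t)"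
    "y t = (1 - \<alpha>) *\<^sub>R y (t - 1) + \<alpha> *\<^sub>R z t"
  using run t unfolding asmd_path_def Let_def \<alpha>_def by blast+

lemma iterates_in:
  assumes run: "asmd_path X \<psi> grad_\<psi> \<eta> T x\<^sub>0 g x y z" and "t \<le> T"
  shows "x t \<in> X \<and> y t \<in> X \<and> z t \<in> X"
  using \<open>t \<le> T\<close>
proof (induction t)
  case 0
  then show ?case using run start by (simp add: asmd_path_def)
next
  case (Suc n)
  define \<alpha> where "\<alpha> = 2 / (real (Suc n) + 1)"
  have "0 \<le> \<alpha>" "\<alpha> \<le> 1" by (auto simp: \<alpha>_def)
  then have combine: "(1 - \<alpha>) *\<^sub>R a + \<alpha> *\<^sub>R b \<in> X" if "a \<in> X" "b \<in> X" for a b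
    using that convexD[OF convex_X, of a b "1 - \<alpha>" \<alpha>] by simp
  have IH: "y n \<in> X" "z n \<in> X" and t: "Suc n \<in> {1..T}" using Suc by auto
  note step = run_step[OF run t, simplified diff_Suc_1, folded \<alpha>_def]
  have z: "z (Suc n) \<in> X" using step(2) by (simp add: is_arg_min_def)
  show ?case unfolding step(1,3) using combine[OF IH] combine[OF IH(1) z] z by blast
qed

text \<open>The telescoping sum of the steps, with weights \<open>w\<close>. Their decrease pays for the multiple
  of \<open>D xstar (z (t - 1))\<close> by which the noise is compensated in \<open>noise_increment\<close>.
  Without weights this term would accumulate.\<close>

lemma weighted_path_bound:
  fixes w \<eta> :: "nat \<Rightarrow> real" and \<sigma> :: real
  assumes run: "asmd_path X \<psi> grad_\<psi> \<eta> T x\<^sub>0 g x y z"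
    and \<eta>: "\<And>t. t \<in> {1..T} \<Longrightarrow> 0 \<le> \<eta> t" "\<And>t. t \<in> {1..T} \<Longrightarrow> \<eta> t \<le> real t / (4 * L)"
    and \<eta>_growth: "\<And>t. t \<in> {1..<T} \<Longrightarrow> real t * \<eta> (Suc t) \<le> (real t + 1) * \<eta> t"
    and w: "\<And>t. t \<le> T \<Longrightarrow> 0 \<le> w t"
    and w_decrease: "\<And>t. t \<in> {1..T} \<Longrightarrow> w t + 4 * \<sigma>\<^sup>2 * (w t * \<eta> t)\<^sup>2 \<le> w (t - 1)"
    and "1 \<le> T"
  shows "w T * ((real T + 1) / 2 * \<eta> T * (f (y T) - f xstar) + D xstar (z T))
    \<le> w 0 * D xstar x\<^sub>0 + (\<Sum>t=1..T.
      noise_increment \<sigma> (2 * w t * (\<eta> t)\<^sup>2) ((w t * \<eta> t) *\<^sub>R (xstar - z (t - 1))) (g t - grad_f (x t))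
      + (4 * \<sigma>\<^sup>2 + 2 * G\<^sup>2) * (w t * (\<eta> t)\<^sup>2))"
proof -
  define \<Delta> where "\<Delta> k = f (y k) - f xstar" for k
  define c where "c k = (if k = 0 then 0 else (real k + 1) / 2 * \<eta> k)" for k
  define inc where "inc t =
    noise_increment \<sigma> (2 * w t * (\<eta> t)\<^sup>2) ((w t * \<eta> t) *\<^sub>R (xstar - z (t - 1))) (g t - grad_f (x t))
      + (4 * \<sigma>\<^sup>2 + 2 * G\<^sup>2) * (w t * (\<eta> t)\<^sup>2)" for t
  have "w n * (c n * \<Delta> n + D xstar (z n)) \<le> w 0 * D xstar x\<^sub>0 + sum inc {1..n}" if "n \<le> T" for n
    using that
  proof (induction n)
    case 0
    then show ?case using run by (simp add: asmd_path_def c_def)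
  next
    case (Suc n)
    define t where "t = Suc n"
    have t: "t \<in> {1..T}" "t - 1 = n" "t \<le> T" using Suc.prems by (auto simp: t_def)
    have IH: "y n \<in> X" "z n \<in> X" and xX: "x t \<in> X" and yX: "y t \<in> X"
      using iterates_in[OF run, of n] iterates_in[OF run, of t] t by auto
    note step = run_step[OF run t(1), unfolded t(2)]
    define \<xi> where "\<xi> = g t - grad_f (x t)"
    define E where "E = noise_increment \<sigma> (2 * w t * (\<eta> t)\<^sup>2) ((w t * \<eta> t) *\<^sub>R (xstar - z n)) \<xi>"
    have "c t * \<Delta> t + D xstar (z t) \<le> (real t - 1) / 2 * \<eta> t * \<Delta> n + D xstar (z n)
        + \<eta> t * (\<xi> \<bullet> (xstar - z n)) + 2 * (\<eta> t)\<^sup>2 * (G\<^sup>2 + (dual_norm N \<xi>)\<^sup>2)"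
      using accelerated_step[OF _ xX IH yX step(1) step(3) step(2) \<eta>[OF t(1)]]
      by (simp add: \<xi>_def \<Delta>_def c_def t_def)
    also have "(real t - 1) / 2 * \<eta> t * \<Delta> n \<le> c n * \<Delta> n"
    proof (cases "n = 0")
      case False
      then have "real n * \<eta> (Suc n) \<le> (real n + 1) * \<eta> n" using Suc.prems by (intro \<eta>_growth) auto
      then show ?thesis
        using False gap_nonneg[OF IH(1)] by (intro mult_right_mono) (auto simp: c_def t_def \<Delta>_def)
    qed (simp add: t_def c_def)
    finally have one: "c t * \<Delta> t + D xstar (z t) \<le> c n * \<Delta> n + D xstar (z n)
        + \<eta> t * (\<xi> \<bullet> (xstar - z n)) + 2 * (\<eta> t)\<^sup>2 * (G\<^sup>2 + (dual_norm N \<xi>)\<^sup>2)" by simp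
    have "w t * (c t * \<Delta> t + D xstar (z t)) \<le> w t * (c n * \<Delta> n + D xstar (z n)
        + \<eta> t * (\<xi> \<bullet> (xstar - z n)) + 2 * (\<eta> t)\<^sup>2 * (G\<^sup>2 + (dual_norm N \<xi>)\<^sup>2))"
      using one w t by (intro mult_left_mono) auto
    also have "\<dots> = w t * (c n * \<Delta> n) + w t * D xstar (z n) + E
        + 2 * \<sigma>\<^sup>2 * (w t * \<eta> t)\<^sup>2 * (N (xstar - z n))\<^sup>2 + (4 * \<sigma>\<^sup>2 + 2 * G\<^sup>2) * (w t * (\<eta> t)\<^sup>2)"
    proof -
      have "(N ((w t * \<eta> t) *\<^sub>R (xstar - z n)))\<^sup>2 = (w t * \<eta> t)\<^sup>2 * (N (xstar - z n))\<^sup>2"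
        by (simp add: norm_scale power_mult_distrib)
      then show ?thesis
        unfolding E_def noise_increment_def inner_scaleR_right by (simp add: algebra_simps power2_eq_square)
    qed
    finally have weighted: "w t * (c t * \<Delta> t + D xstar (z t)) \<le> w t * (c n * \<Delta> n) + w t * D xstar (z n) + E
        + 2 * \<sigma>\<^sup>2 * (w t * \<eta> t)\<^sup>2 * (N (xstar - z n))\<^sup>2 + (4 * \<sigma>\<^sup>2 + 2 * G\<^sup>2) * (w t * (\<eta> t)\<^sup>2)" .
    have gap: "w t * (c n * \<Delta> n) \<le> w n * (c n * \<Delta> n)"
    proof (rule mult_right_mono)
      have "0 \<le> 4 * \<sigma>\<^sup>2 * (w t * \<eta> t)\<^sup>2" by simp
      then show "w t \<le> w n" using w_decrease[OF t(1), unfolded t(2)] by linarith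
      show "0 \<le> c n * \<Delta> n" using gap_nonneg[OF IH(1)] \<eta>(1)[of n] Suc.prems by (auto simp: c_def \<Delta>_def)
    qed
    have "2 * \<sigma>\<^sup>2 * (w t * \<eta> t)\<^sup>2 * (N (xstar - z n))\<^sup>2 \<le> 4 * \<sigma>\<^sup>2 * (w t * \<eta> t)\<^sup>2 * D xstar (z n)"
      using mult_left_mono[OF bregman_lower[OF xstar_in IH(2)], of "4 * \<sigma>\<^sup>2 * (w t * \<eta> t)\<^sup>2"] by simp
    moreover have "(w t + 4 * \<sigma>\<^sup>2 * (w t * \<eta> t)\<^sup>2) * D xstar (z n) \<le> w n * D xstar (z n)"
      using w_decrease[OF t(1)] t(2) bregman_nonneg[OF xstar_in IH(2)] by (intro mult_right_mono) auto
    ultimately have "w t * D xstar (z n) + 2 * \<sigma>\<^sup>2 * (w t * \<eta> t)\<^sup>2 * (N (xstar - z n))\<^sup>2 \<le> w n * D xstar (z n)"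
      unfolding distrib_right by linarith
    with weighted gap have "w t * (c t * \<Delta> t + D xstar (z t))
        \<le> w n * (c n * \<Delta> n + D xstar (z n)) + E + (4 * \<sigma>\<^sup>2 + 2 * G\<^sup>2) * (w t * (\<eta> t)\<^sup>2)"
      unfolding distrib_left[of "w n"] by linarith
    moreover have "inc t = E + (4 * \<sigma>\<^sup>2 + 2 * G\<^sup>2) * (w t * (\<eta> t)\<^sup>2)"
      by (simp only: inc_def E_def \<xi>_def t(2))
    moreover have "w n * (c n * \<Delta> n + D xstar (z n)) \<le> w 0 * D xstar x\<^sub>0 + sum inc {1..n}"
      using Suc by simp
    moreover have "sum inc {1..t} = sum inc {1..n} + inc t" by (simp add: t_def)
    ultimately show ?case unfolding t_def[symmetric] by linarith
  qed
  from this[of T] show ?thesis using \<open>1 \<le> T\<close> by (simp add: c_def \<Delta>_def inc_def)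
qed

text \<open>A mirror step of length zero minimizes the divergence from the current point alone.\<close>

lemma stationary_path:
  assumes run: "asmd_path X \<psi> grad_\<psi> \<eta> T x\<^sub>0 g x y z"
    and \<eta>: "\<And>t. t \<in> {1..T} \<Longrightarrow> \<eta> t = 0" and "n \<le> T"
  shows "y n = x\<^sub>0 \<and> z n = x\<^sub>0"
  using \<open>n \<le> T\<close>
proof (induction n)
  case 0
  then show ?case using run by (simp add: asmd_path_def)
next
  case (Suc n)
  then have n: "y n = x\<^sub>0" "z n = x\<^sub>0" "Suc n \<in> {1..T}" by auto
  note step = run_step[OF run n(3), simplified diff_Suc_1]
  have "D (z (Suc n)) x\<^sub>0 \<le> D x\<^sub>0 x\<^sub>0" "z (Suc n) \<in> X"
    using step(2) start \<eta>[OF n(3)] n(2) by (auto simp: is_arg_min_def not_less)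
  then have "z (Suc n) = x\<^sub>0" using bregman_eq_zero start by (simp add: bregman_self)
  then show ?case using step(3) n(1) by (simp flip: scaleR_add_left)
qed

end

section \<open>A harmonic sum\<close>

lemma sum_inverse_le_ln:
  assumes "1 \<le> n"
  shows "(\<Sum>t=1..n. 1 / real t) \<le> 1 + ln (real n)"
  using assms
proof (induction n rule: nat_induct_at_least)
  case (Suc n)
  have "ln (real n / (real n + 1)) \<le> real n / (real n + 1) - 1"
    using Suc by (intro ln_le_minus_one) auto
  also have "\<dots> = - (1 / (real n + 1))" by (simp add: field_simps)
  finally have "1 / (real n + 1) \<le> ln (real n + 1) - ln (real n)"
    using Suc by (simp add: ln_div)
  then show ?case using Suc by (simp add: add.commute)
qed simp

section \<open>The iterates are predictable\<close>

lemma space_noise_history: "space (noise_history M \<xi> t) = space M"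
  unfolding noise_history_def by (rule space_measure_of) auto

lemma sets_noise_history:
  "sets (noise_history M \<xi> t)
    = sigma_sets (space M) {\<xi> s -` A \<inter> space M | s A. s \<in> {1..<t} \<and> A \<in> sets borel}"
  unfolding noise_history_def by (rule sets_measure_of) auto

lemma subalgebra_noise_history:
  assumes "\<And>s. s \<in> {1..<t} \<Longrightarrow> \<xi> s \<in> borel_measurable M"
  shows "subalgebra M (noise_history M \<xi> t)"
  unfolding subalgebra_def space_noise_history sets_noise_history
  using assms by (auto intro!: sets.sigma_sets_subset dest: measurable_sets)

lemma noise_history_mono:
  assumes "s \<le> t"
  shows "subalgebra (noise_history M \<xi> t) (noise_history M \<xi> s)"
  unfolding subalgebra_def space_noise_history sets_noise_history
  using assms by (fastforce intro!: sigma_sets_mono')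

lemma noise_measurable_history:
  assumes "s \<in> {1..<t}"
  shows "\<xi> s \<in> borel_measurable (noise_history M \<xi> t)"
  by (rule measurableI) (use assms in \<open>auto simp: space_noise_history sets_noise_history\<close>)

locale stochastic_run =
  composite_problem N X \<psi> grad_\<psi> f grad_f G L xstar x\<^sub>0 + prob_space M
  for N :: "'a::euclidean_space \<Rightarrow> real" and X \<psi> grad_\<psi> f grad_f G L xstar x\<^sub>0
    and M :: "'w measure" +
  fixes T :: nat and \<eta> :: "nat \<Rightarrow> real" and \<sigma> :: real and g x y z \<xi> :: "nat \<Rightarrow> 'w \<Rightarrow> 'a"
  defines "\<xi> \<equiv> \<lambda>t \<omega>. g t \<omega> - grad_f (x t \<omega>)"
  assumes T: "1 \<le> T" and \<sigma>: "0 < \<sigma>"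
    and run: "\<omega> \<in> space M \<Longrightarrow>
      asmd_path X \<psi> grad_\<psi> \<eta> T x\<^sub>0 (\<lambda>t. g t \<omega>) (\<lambda>t. x t \<omega>) (\<lambda>t. y t \<omega>) (\<lambda>t. z t \<omega>)"
    and unbiased: "t \<in> {1..T} \<Longrightarrow> cond_mean_zero M (noise_history M \<xi> t) (\<xi> t)"
    and subgaussian: "t \<in> {1..T} \<Longrightarrow>
      cond_subgaussian M (noise_history M \<xi> t) \<sigma> (\<lambda>\<omega>. dual_norm N (\<xi> t \<omega>))"
begin

abbreviation F where "F \<equiv> noise_history M \<xi>"

lemma noise_measurable: "t \<in> {1..T} \<Longrightarrow> \<xi> t \<in> borel_measurable M"
  using unbiased[of t] by (auto simp: cond_mean_zero_def simp del: atLeastAtMost_iff)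

lemma subalgebra_F: "t \<le> Suc T \<Longrightarrow> subalgebra M (F t)"
  by (intro subalgebra_noise_history noise_measurable) auto

text \<open>The oracle answer is the noise plus the gradient at a predictable point, so every iterate is a
  Borel function of the past noise.\<close>

lemma iterates_predictable:
  "n \<le> T \<Longrightarrow> y n \<in> borel_measurable (F (Suc n)) \<and> z n \<in> borel_measurable (F (Suc n))"
proof (induction n)
  case 0
  have const: "(\<lambda>\<omega>. x\<^sub>0) \<in> borel_measurable (F (Suc 0))" by simp
  have eq: "y 0 \<omega> = x\<^sub>0" "z 0 \<omega> = x\<^sub>0" if "\<omega> \<in> space (F (Suc 0))" for \<omega>
    using run[of \<omega>] that by (auto simp: asmd_path_def space_noise_history)
  show ?case
    using measurable_cong[THEN iffD2, OF eq(1) const] measurable_cong[THEN iffD2, OF eq(2) const] ..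
next
  case (Suc n)
  define t where "t = Suc n"
  define \<alpha> where "\<alpha> = 2 / (real t + 1)"
  have t: "t \<in> {1..T}" "t - 1 = n" using Suc.prems by (auto simp: t_def)
  let ?F = "F (Suc t)"
  have step: "x t \<omega> = (1 - \<alpha>) *\<^sub>R y n \<omega> + \<alpha> *\<^sub>R z n \<omega>"
      "is_arg_min (\<lambda>u. \<eta> t * (g t \<omega> \<bullet> u) + D u (z n \<omega>)) (\<lambda>u. u \<in> X) (z t \<omega>)"
      "y t \<omega> = (1 - \<alpha>) *\<^sub>R y n \<omega> + \<alpha> *\<^sub>R z t \<omega>" if "\<omega> \<in> space ?F" for \<omega>
    using run_step[OF run t(1), of \<omega>] that
    unfolding t(2) \<alpha>_def[symmetric] space_noise_history by auto
  have "subalgebra ?F (F t)" by (rule noise_history_mono) simp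
  then have yz [measurable]: "y n \<in> borel_measurable ?F" "z n \<in> borel_measurable ?F"
    using Suc by (auto simp: t_def intro: measurable_from_subalg)
  have [measurable]: "grad_f \<in> borel_measurable borel" "grad_\<psi> \<in> borel_measurable borel"
    using gradient_measurable[OF grad_f] gradient_measurable[OF grad_\<psi>] by auto
  have [measurable]: "\<xi> t \<in> borel_measurable ?F" by (rule noise_measurable_history) (use t in auto)
  have "(\<lambda>\<omega>. (1 - \<alpha>) *\<^sub>R y n \<omega> + \<alpha> *\<^sub>R z n \<omega>) \<in> borel_measurable ?F" by measurable
  moreover have "x t \<in> borel_measurable ?F
      \<longleftrightarrow> (\<lambda>\<omega>. (1 - \<alpha>) *\<^sub>R y n \<omega> + \<alpha> *\<^sub>R z n \<omega>) \<in> borel_measurable ?F"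
    by (intro measurable_cong step(1))
  ultimately have [measurable]: "x t \<in> borel_measurable ?F" by blast
  have "(\<lambda>\<omega>. \<xi> t \<omega> + grad_f (x t \<omega>)) \<in> borel_measurable ?F" by measurable
  also have "(\<lambda>\<omega>. \<xi> t \<omega> + grad_f (x t \<omega>)) = g t" by (simp add: \<xi>_def)
  finally have [measurable]: "g t \<in> borel_measurable ?F" .
  obtain Q where [measurable]: "Q \<in> borel_measurable borel"
    and Q: "\<forall>e v z' u. is_arg_min (\<lambda>u. e * (v \<bullet> u) + D u z') (\<lambda>u. u \<in> X) u \<longrightarrow>
       u = Q (e *\<^sub>R v - grad_\<psi> z')"
    using mirror_step_measurable by blast
  have "(\<lambda>\<omega>. Q (\<eta> t *\<^sub>R g t \<omega> - grad_\<psi> (z n \<omega>))) \<in> borel_measurable ?F" by measurable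
  moreover have "z t \<in> borel_measurable ?F
      \<longleftrightarrow> (\<lambda>\<omega>. Q (\<eta> t *\<^sub>R g t \<omega> - grad_\<psi> (z n \<omega>))) \<in> borel_measurable ?F"
    by (intro measurable_cong Q[rule_format] step(2))
  ultimately have z [measurable]: "z t \<in> borel_measurable ?F" by blast
  have "(\<lambda>\<omega>. (1 - \<alpha>) *\<^sub>R y n \<omega> + \<alpha> *\<^sub>R z t \<omega>) \<in> borel_measurable ?F" by measurable
  moreover have "y t \<in> borel_measurable ?F
      \<longleftrightarrow> (\<lambda>\<omega>. (1 - \<alpha>) *\<^sub>R y n \<omega> + \<alpha> *\<^sub>R z t \<omega>) \<in> borel_measurable ?F"
    by (intro measurable_cong step(3))
  ultimately have "y t \<in> borel_measurable ?F" by blast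
  then show ?case using z by (simp add: t_def)
qed

lemma outputs_measurable:
  "(\<lambda>\<omega>. D xstar (z T \<omega>)) \<in> borel_measurable M" "(\<lambda>\<omega>. f (y T \<omega>)) \<in> borel_measurable M"
proof -
  have [measurable]: "y T \<in> borel_measurable M" "z T \<in> borel_measurable M"
    using iterates_predictable[of T] measurable_from_subalg[OF subalgebra_F[of "Suc T"]] by auto
  have [measurable]: "grad_\<psi> \<in> borel_measurable borel" "f \<in> borel_measurable borel"
      "\<psi> \<in> borel_measurable borel"
    using gradient_measurable[OF grad_\<psi>]
      borel_measurable_continuous_onI[OF GDERIV_continuous_on[of f grad_f]] grad_f
      borel_measurable_continuous_onI[OF GDERIV_continuous_on[of \<psi> grad_\<psi>]] grad_\<psi> by auto
  show "(\<lambda>\<omega>. D xstar (z T \<omega>)) \<in> borel_measurable M" unfolding bregman_def by measurable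
  show "(\<lambda>\<omega>. f (y T \<omega>)) \<in> borel_measurable M" by measurable
qed

section \<open>High-probability bound for general step sizes\<close>

text \<open>With \<open>A\<close> the sum of all squared steps, the weights are
  \<open>w t = 1 / (6 \<sigma>\<^sup>2 (A + (\<Sum>s\<le>t. \<eta> s\<^sup>2)))\<close>. Their reciprocals increase by
  \<open>6 \<sigma>\<^sup>2 (\<eta> t)\<^sup>2\<close>, which is the decrease required for the telescoping. Starting the
  denominator at \<open>A\<close> makes \<open>w 0 = 2 w T\<close> and keeps the quadratic noise term within the range
  of the sub-Gaussian condition.\<close>

lemma high_probability_bound:
  assumes \<delta>: "0 < \<delta>" "\<delta> < 1"
    and \<eta>: "\<And>t. t \<in> {1..T} \<Longrightarrow> 0 < \<eta> t" "\<And>t. t \<in> {1..T} \<Longrightarrow> \<eta> t \<le> real t / (4 * L)"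
    and \<eta>_growth: "\<And>t. t \<in> {1..<T} \<Longrightarrow> real t * \<eta> (Suc t) \<le> (real t + 1) * \<eta> t"
  defines "A \<equiv> \<Sum>t=1..T. (\<eta> t)\<^sup>2"
  shows "1 - \<delta> \<le> measure M {\<omega> \<in> space M.
    (real T + 1) / 2 * \<eta> T * (f (y T \<omega>) - f xstar) + D xstar (z T \<omega>)
      \<le> 2 * D xstar x\<^sub>0 + 12 * (G\<^sup>2 + \<sigma>\<^sup>2 * (1 + ln (1 / \<delta>))) * A}"
proof -
  define B where "B t = A + (\<Sum>s=1..t. (\<eta> s)\<^sup>2)" for t
  define w where "w t = 1 / (6 * \<sigma>\<^sup>2 * B t)" for t
  define b where "b t = 2 * w t * (\<eta> t)\<^sup>2" for t
  define u where "u t \<omega> = (w t * \<eta> t) *\<^sub>R (xstar - z (t - 1) \<omega>)" for t \<omega>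
  define E where "E \<omega> = (\<Sum>t=1..T. noise_increment \<sigma> (b t) (u t \<omega>) (\<xi> t \<omega>))" for \<omega>
  define P where "P \<omega> = (real T + 1) / 2 * \<eta> T * (f (y T \<omega>) - f xstar) + D xstar (z T \<omega>)" for \<omega>
  have \<sigma>2: "0 < \<sigma>\<^sup>2" using \<sigma> by simp
  have "(\<eta> T)\<^sup>2 \<le> A" unfolding A_def using T by (intro member_le_sum) auto
  moreover have "0 < (\<eta> T)\<^sup>2" using \<eta>(1)[of T] T by simp
  ultimately have A: "0 < A" by linarith
  have AB: "A \<le> B t" for t unfolding B_def by (simp add: sum_nonneg)
  have B: "0 < B t" for t using A AB[of t] by linarith
  have w0: "0 < w t" for t unfolding w_def using B \<sigma>2 by simp
  have wB: "6 * \<sigma>\<^sup>2 * B t * w t = 1" for t unfolding w_def using B[of t] \<sigma>2 by simp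
  have B_step: "B t = B (t - 1) + (\<eta> t)\<^sup>2" if "t \<in> {1..T}" for t
    using that by (cases t) (auto simp: B_def)

  have w_decrease: "w t + 4 * \<sigma>\<^sup>2 * (w t * \<eta> t)\<^sup>2 \<le> w (t - 1)" if t: "t \<in> {1..T}" for t
  proof -
    have "4 * \<sigma>\<^sup>2 * (w t)\<^sup>2 \<le> 6 * \<sigma>\<^sup>2 * (w t * w (t - 1))"
    proof -
      have "w t \<le> w (t - 1)"
        unfolding w_def using B_step[OF t] \<sigma>2
        by (intro divide_left_mono mult_left_mono mult_pos_pos B) auto
      then have "\<sigma>\<^sup>2 * (w t * w t) \<le> \<sigma>\<^sup>2 * (w t * w (t - 1))" "0 \<le> \<sigma>\<^sup>2 * (w t * w t)"
        using w0[of t] \<sigma>2 by (auto intro!: mult_left_mono)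
      then show ?thesis unfolding power2_eq_square[of "w t"] by linarith
    qed
    then have "4 * \<sigma>\<^sup>2 * (w t)\<^sup>2 * (\<eta> t)\<^sup>2 \<le> 6 * \<sigma>\<^sup>2 * (w t * w (t - 1)) * (\<eta> t)\<^sup>2"
      by (intro mult_right_mono) auto
    also have "\<dots> = w (t - 1) * (6 * \<sigma>\<^sup>2 * B t * w t) - w t * (6 * \<sigma>\<^sup>2 * B (t - 1) * w (t - 1))"
      unfolding B_step[OF t] by (simp add: algebra_simps)
    also have "\<dots> = w (t - 1) - w t" by (simp only: wB mult_1_right)
    finally show ?thesis by (simp add: power_mult_distrib algebra_simps)
  qed
  have wA: "w t \<le> w 0" for t
  proof -
    have "B 0 \<le> B t" using AB[of t] by (simp add: B_def)
    then show ?thesis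
      unfolding w_def using \<sigma>2 by (intro divide_left_mono mult_left_mono mult_pos_pos B) auto
  qed
  have wT: "w 0 = 2 * w T" "12 * \<sigma>\<^sup>2 * A * w T = 1"
  proof -
    have "B 0 = A" "B T = 2 * A" by (simp_all only: B_def A_def) simp_all
    then show "w 0 = 2 * w T" "12 * \<sigma>\<^sup>2 * A * w T = 1" using A \<sigma> by (simp_all add: w_def)
  qed

  have "1 - \<delta> \<le> measure M {\<omega> \<in> space M. E \<omega> \<le> ln (1 / \<delta>)}"
    unfolding E_def
  proof (rule noise_concentration)
    fix t assume t: "t \<in> {1..T}"
    show "0 \<le> b t" unfolding b_def using w0[of t] by simp
    have "(\<eta> t)\<^sup>2 \<le> A" unfolding A_def using t by (intro member_le_sum) auto
    moreover have "(\<eta> t)\<^sup>2 \<le> B t - A" unfolding B_def using t by (auto intro: member_le_sum)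
    ultimately have "2 * (\<eta> t)\<^sup>2 \<le> B t" by linarith
    then show "6 * b t * \<sigma>\<^sup>2 \<le> 1"
      unfolding b_def w_def using B[of t] \<sigma>2 by (simp add: field_simps)
  next
    fix s t assume "s \<in> {1..t}" "t \<le> T"
    then have "z (s - 1) \<in> borel_measurable (F s)" "subalgebra (F t) (F s)"
      using iterates_predictable[of "s - 1"] by (auto intro: noise_history_mono)
    then have [measurable]: "z (s - 1) \<in> borel_measurable (F t)"
      using measurable_from_subalg by blast
    show "u s \<in> borel_measurable (F t)" unfolding u_def by measurable
  next
    fix s t :: nat assume "s \<in> {1..<t}"
    then show "\<xi> s \<in> borel_measurable (F t)" by (rule noise_measurable_history)
  qed (use prob_space_axioms subalgebra_F unbiased subgaussian \<sigma> \<delta> in auto)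
  also have "\<dots> \<le> measure M {\<omega> \<in> space M.
      P \<omega> \<le> 2 * D xstar x\<^sub>0 + 12 * (G\<^sup>2 + \<sigma>\<^sup>2 * (1 + ln (1 / \<delta>))) * A}"
  proof (rule finite_measure_mono)
    show "{\<omega> \<in> space M. P \<omega> \<le> 2 * D xstar x\<^sub>0 + 12 * (G\<^sup>2 + \<sigma>\<^sup>2 * (1 + ln (1 / \<delta>))) * A} \<in> sets M"
      unfolding P_def using outputs_measurable by measurable
    show "{\<omega> \<in> space M. E \<omega> \<le> ln (1 / \<delta>)}
        \<subseteq> {\<omega> \<in> space M. P \<omega> \<le> 2 * D xstar x\<^sub>0 + 12 * (G\<^sup>2 + \<sigma>\<^sup>2 * (1 + ln (1 / \<delta>))) * A}"
    proof safe
      fix \<omega> assume \<omega>: "\<omega> \<in> space M" and E: "E \<omega> \<le> ln (1 / \<delta>)"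
      have "w T * P \<omega> \<le> w 0 * D xstar x\<^sub>0
          + (\<Sum>t=1..T. noise_increment \<sigma> (b t) (u t \<omega>) (\<xi> t \<omega>)
            + (4 * \<sigma>\<^sup>2 + 2 * G\<^sup>2) * (w t * (\<eta> t)\<^sup>2))"
        unfolding P_def b_def u_def \<xi>_def
        using \<eta> \<eta>_growth w0 w_decrease T
        by (intro weighted_path_bound[OF run[OF \<omega>]]) (auto intro: less_imp_le)
      also have "\<dots> = w 0 * D xstar x\<^sub>0 + E \<omega>
          + (4 * \<sigma>\<^sup>2 + 2 * G\<^sup>2) * (\<Sum>t=1..T. w t * (\<eta> t)\<^sup>2)"
        by (simp add: E_def sum.distrib sum_distrib_left)
      also have "\<dots> \<le> w 0 * D xstar x\<^sub>0 + ln (1 / \<delta>) + (4 * \<sigma>\<^sup>2 + 2 * G\<^sup>2) * (w 0 * A)"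
        unfolding A_def sum_distrib_left using E wA less_imp_le[OF w0[of 0]]
        by (intro add_mono mult_left_mono sum_mono mult_right_mono) auto
      also have "\<dots> = 2 * w T * D xstar x\<^sub>0 + ln (1 / \<delta>) * (12 * \<sigma>\<^sup>2 * A * w T)
          + (4 * \<sigma>\<^sup>2 + 2 * G\<^sup>2) * (2 * w T * A)"
        by (simp only: wT mult_1_right)
      also have "\<dots> = w T * (2 * D xstar x\<^sub>0 + 12 * \<sigma>\<^sup>2 * ln (1 / \<delta>) * A + (8 * \<sigma>\<^sup>2 + 4 * G\<^sup>2) * A)"
        by (simp add: algebra_simps)
      finally have "P \<omega> \<le> 2 * D xstar x\<^sub>0 + 12 * \<sigma>\<^sup>2 * ln (1 / \<delta>) * A + (8 * \<sigma>\<^sup>2 + 4 * G\<^sup>2) * A"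
        using w0[of T] by (simp only: mult_le_cancel_left_pos)
      also have "(8 * \<sigma>\<^sup>2 + 4 * G\<^sup>2) * A \<le> (12 * \<sigma>\<^sup>2 + 12 * G\<^sup>2) * A"
        using A by (intro mult_right_mono add_mono) auto
      finally show "P \<omega> \<le> 2 * D xstar x\<^sub>0 + 12 * (G\<^sup>2 + \<sigma>\<^sup>2 * (1 + ln (1 / \<delta>))) * A"
        by (simp add: algebra_simps)
    qed
  qed
  finally show ?thesis unfolding P_def .
qed

section \<open>The two step size schedules\<close>

lemma noise_scale_pos:
  assumes "0 < \<delta>" "\<delta> < 1"
  shows "0 < G\<^sup>2 + \<sigma>\<^sup>2 * (1 + ln (1 / \<delta>))"
proof (rule add_nonneg_pos)
  show "0 < \<sigma>\<^sup>2 * (1 + ln (1 / \<delta>))"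
    using \<sigma> assms by (intro mult_pos_pos add_pos_pos) (auto simp: ln_div)
qed simp

text \<open>Both schedules end with the same step \<open>\<eta> T\<close>; they differ in the sum of squares, which \<open>\<kappa>\<close>
  compares with the sum \<open>c\<^sup>2\<close> for constant steps \<open>c / sqrt T\<close>. In terms of \<open>c\<close> the
  constants become polynomial, as \<open>D\<^sub>0 = 6 S c\<^sup>2\<close>. The second bound on the sum is for the function
  value, where the sum gets divided by \<open>\<eta> T\<close>, which can be much smaller than \<open>c / sqrt T\<close>.\<close>

lemma schedule_guarantee:
  fixes \<delta> \<kappa> :: real
  defines "S \<equiv> G\<^sup>2 + \<sigma>\<^sup>2 * (1 + ln (1 / \<delta>))" and "D\<^sub>0 \<equiv> D xstar x\<^sub>0"
  defines "c \<equiv> sqrt D\<^sub>0 / (sqrt 6 * sqrt S)"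
  assumes \<delta>: "0 < \<delta>" "\<delta> < 1" and D\<^sub>0: "0 < D\<^sub>0"
    and \<eta>: "\<And>t. t \<in> {1..T} \<Longrightarrow> 0 < \<eta> t" "\<And>t. t \<in> {1..T} \<Longrightarrow> \<eta> t \<le> real t / (4 * L)"
    and \<eta>_growth: "\<And>t. t \<in> {1..<T} \<Longrightarrow> real t * \<eta> (Suc t) \<le> (real t + 1) * \<eta> t"
    and \<eta>_T: "\<eta> T = min (real T / (4 * L)) (c / sqrt (real T))"
    and sq: "(\<Sum>t=1..T. (\<eta> t)\<^sup>2) \<le> \<kappa> * c\<^sup>2"
      "(\<Sum>t=1..T. (\<eta> t)\<^sup>2) \<le> \<kappa> * (\<eta> T * (c / sqrt (real T)) * (real T + 1))"
  shows "1 - \<delta> \<le> measure M {\<omega> \<in> space M.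
    D xstar (z T \<omega>) \<le> (2 + 2 * \<kappa>) * D\<^sub>0 \<and>
    f (y T \<omega>) - f xstar \<le> 16 * L * D\<^sub>0 / (real T)\<^sup>2
      + 4 * sqrt 6 * (1 + \<kappa>) / sqrt (real T) * sqrt (D\<^sub>0 * S)}"
proof -
  define R where "R = sqrt (real T)"
  define A where "A = (\<Sum>t=1..T. (\<eta> t)\<^sup>2)"
  have R: "0 < R" "R * R = real T" using T by (auto simp: R_def)
  have S: "0 < S" unfolding S_def by (rule noise_scale_pos[OF \<delta>])
  have c: "0 < c" using D\<^sub>0 S by (simp add: c_def)
  have D\<^sub>0_c: "D\<^sub>0 = 6 * S * c\<^sup>2" using D\<^sub>0 S by (simp add: c_def power_divide power_mult_distrib)
  have root: "sqrt (D\<^sub>0 * S) = sqrt 6 * S * c"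
    using S c by (simp add: D\<^sub>0_c real_sqrt_mult real_sqrt_power power2_eq_square)
  have \<eta>T: "0 < \<eta> T" using \<eta>(1)[of T] T by simp

  have main: "2 * D\<^sub>0 \<le> (real T + 1) / 2 * \<eta> T * (16 * L * D\<^sub>0 / (real T)\<^sup>2 + 24 * S * c / R)"
  proof -
    have "1 \<le> \<eta> T * (4 * L / real T + R / c)"
    proof (cases "\<eta> T = real T / (4 * L)")
      case True
      then have "\<eta> T * (4 * L / real T) = 1" using T GL by simp
      moreover have "0 \<le> \<eta> T * (R / c)" using \<eta>T R c by simp
      ultimately show ?thesis unfolding distrib_left by linarith
    next
      case False
      then have "\<eta> T = c / R" using \<eta>_T by (simp add: R_def min_def split: if_splits)
      then have "\<eta> T * (R / c) = 1" using R c by simp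
      moreover have "0 \<le> \<eta> T * (4 * L / real T)" using \<eta>T GL by simp
      ultimately show ?thesis unfolding distrib_left by linarith
    qed
    moreover have "1 \<le> (real T + 1) / real T" using T by simp
    ultimately have "1 * 1 \<le> (real T + 1) / real T * (\<eta> T * (4 * L / real T + R / c))"
      by (intro mult_mono) auto
    then have "2 * D\<^sub>0 * 1 \<le> 2 * D\<^sub>0 * ((real T + 1) / real T * (\<eta> T * (4 * L / real T + R / c)))"
      using D\<^sub>0 by (intro mult_left_mono) auto
    also have "\<dots> = (real T + 1) / 2 * \<eta> T * (16 * L * D\<^sub>0 / (real T)\<^sup>2 + 4 * D\<^sub>0 * (R / (real T * c)))"
      using T by (simp add: field_simps power2_eq_square)
    also have "4 * D\<^sub>0 * (R / (real T * c)) = 24 * S * c / R"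
      using R c by (simp add: D\<^sub>0_c R(2)[symmetric] power2_eq_square)
    finally show ?thesis by simp
  qed
  have square_sum: "12 * S * A \<le> (real T + 1) / 2 * \<eta> T * (24 * \<kappa> * S * c / R)"
  proof -
    have "12 * S * A \<le> 12 * S * (\<kappa> * (\<eta> T * (c / R) * (real T + 1)))"
      unfolding A_def R_def using sq(2) S by (intro mult_left_mono) auto
    also have "\<dots> = (real T + 1) / 2 * \<eta> T * (24 * \<kappa> * S * c / R)"
      using R(1) by (simp add: field_simps)
    finally show ?thesis .
  qed

  have "1 - \<delta> \<le> measure M {\<omega> \<in> space M.
      (real T + 1) / 2 * \<eta> T * (f (y T \<omega>) - f xstar) + D xstar (z T \<omega>) \<le> 2 * D\<^sub>0 + 12 * S * A}"
    using high_probability_bound[OF \<delta> \<eta> \<eta>_growth] by (simp add: S_def D\<^sub>0_def A_def)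
  also have "\<dots> \<le> measure M {\<omega> \<in> space M.
    D xstar (z T \<omega>) \<le> (2 + 2 * \<kappa>) * D\<^sub>0 \<and>
    f (y T \<omega>) - f xstar \<le> 16 * L * D\<^sub>0 / (real T)\<^sup>2
      + 4 * sqrt 6 * (1 + \<kappa>) / sqrt (real T) * sqrt (D\<^sub>0 * S)}"
  proof (rule finite_measure_mono)
    show "{\<omega> \<in> space M.
      D xstar (z T \<omega>) \<le> (2 + 2 * \<kappa>) * D\<^sub>0 \<and>
      f (y T \<omega>) - f xstar \<le> 16 * L * D\<^sub>0 / (real T)\<^sup>2
        + 4 * sqrt 6 * (1 + \<kappa>) / sqrt (real T) * sqrt (D\<^sub>0 * S)} \<in> sets M"
      using outputs_measurable by measurable
  next
    have "D xstar (z T \<omega>) \<le> (2 + 2 * \<kappa>) * D\<^sub>0 \<and>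
        f (y T \<omega>) - f xstar \<le> 16 * L * D\<^sub>0 / (real T)\<^sup>2
          + 4 * sqrt 6 * (1 + \<kappa>) / sqrt (real T) * sqrt (D\<^sub>0 * S)"
      if \<omega>: "\<omega> \<in> space M" and bound: "(real T + 1) / 2 * \<eta> T * (f (y T \<omega>) - f xstar)
        + D xstar (z T \<omega>) \<le> 2 * D\<^sub>0 + 12 * S * A" for \<omega>
    proof
      have X: "y T \<omega> \<in> X" "z T \<omega> \<in> X" using iterates_in[OF run[OF \<omega>], of T] by auto
      have "0 \<le> (real T + 1) / 2 * \<eta> T * (f (y T \<omega>) - f xstar)"
        using gap_nonneg[OF X(1)] \<eta>T by simp
      then have "D xstar (z T \<omega>) \<le> 2 * D\<^sub>0 + 12 * S * A" using bound by linarith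
      also have "12 * S * A \<le> 12 * S * (\<kappa> * c\<^sup>2)" using sq(1) S by (simp add: A_def)
      finally show "D xstar (z T \<omega>) \<le> (2 + 2 * \<kappa>) * D\<^sub>0" by (simp add: D\<^sub>0_c algebra_simps)
      have "(real T + 1) / 2 * \<eta> T * (f (y T \<omega>) - f xstar) \<le> 2 * D\<^sub>0 + 12 * S * A"
        using bound bregman_nonneg[OF xstar_in X(2)] by linarith
      also have "\<dots> \<le> (real T + 1) / 2 * \<eta> T * (16 * L * D\<^sub>0 / (real T)\<^sup>2 + 24 * S * c / R)
          + (real T + 1) / 2 * \<eta> T * (24 * \<kappa> * S * c / R)"
        using main square_sum by linarith
      also have "\<dots> = (real T + 1) / 2 * \<eta> T * (16 * L * D\<^sub>0 / (real T)\<^sup>2 + 24 * (1 + \<kappa>) * S * c / R)"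
        by (simp add: algebra_simps add_divide_distrib)
      finally have "f (y T \<omega>) - f xstar \<le> 16 * L * D\<^sub>0 / (real T)\<^sup>2 + 24 * (1 + \<kappa>) * S * c / R"
        by (rule mult_left_le_imp_le) (use \<eta>T in simp)
      also have "24 * (1 + \<kappa>) * S * c / R = 4 * sqrt 6 * (1 + \<kappa>) / sqrt (real T) * sqrt (D\<^sub>0 * S)"
      proof -
        have "4 * sqrt 6 * (1 + \<kappa>) / R * (sqrt 6 * S * c) = 4 * (sqrt 6 * sqrt 6) * (1 + \<kappa>) * S * c / R"
          by (simp only: times_divide_eq_left times_divide_eq_right ac_simps)
        also have "sqrt 6 * sqrt 6 = (6 :: real)" by simp
        finally have e: "4 * sqrt 6 * (1 + \<kappa>) / R * (sqrt 6 * S * c) = 4 * 6 * (1 + \<kappa>) * S * c / R" .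
        show ?thesis unfolding root R_def[symmetric] e by simp
      qed
      finally show "f (y T \<omega>) - f xstar \<le> 16 * L * D\<^sub>0 / (real T)\<^sup>2
          + 4 * sqrt 6 * (1 + \<kappa>) / sqrt (real T) * sqrt (D\<^sub>0 * S)" .
    qed
    then show "{\<omega> \<in> space M. (real T + 1) / 2 * \<eta> T * (f (y T \<omega>) - f xstar)
        + D xstar (z T \<omega>) \<le> 2 * D\<^sub>0 + 12 * S * A}
      \<subseteq> {\<omega> \<in> space M. D xstar (z T \<omega>) \<le> (2 + 2 * \<kappa>) * D\<^sub>0 \<and>
        f (y T \<omega>) - f xstar \<le> 16 * L * D\<^sub>0 / (real T)\<^sup>2
          + 4 * sqrt 6 * (1 + \<kappa>) / sqrt (real T) * sqrt (D\<^sub>0 * S)}"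
      by blast
  qed
  finally show ?thesis .
qed

lemma linear_schedule_guarantee:
  fixes \<delta> :: real
  defines "S \<equiv> G\<^sup>2 + \<sigma>\<^sup>2 * (1 + ln (1 / \<delta>))" and "D\<^sub>0 \<equiv> D xstar x\<^sub>0"
  defines "c \<equiv> sqrt D\<^sub>0 / (sqrt 6 * sqrt S)"
  assumes \<delta>: "0 < \<delta>" "\<delta> < 1" and D\<^sub>0: "0 < D\<^sub>0"
    and sched: "\<And>t. t \<in> {1..T} \<Longrightarrow> \<eta> t = min (real t / (4 * L)) (c * real t / sqrt (real T) ^ 3)"
  shows "1 - \<delta> \<le> measure M {\<omega> \<in> space M.
    D xstar (z T \<omega>) \<le> (2 + 2 * 1) * D\<^sub>0 \<and>
    f (y T \<omega>) - f xstar \<le> 16 * L * D\<^sub>0 / (real T)\<^sup>2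
      + 4 * sqrt 6 * (1 + 1) / sqrt (real T) * sqrt (D\<^sub>0 * S)}"
proof -
  have S: "0 < S" unfolding S_def by (rule noise_scale_pos[OF \<delta>])
  have c: "0 < c" using D\<^sub>0 S by (simp add: c_def)
  define R where "R = sqrt (real T)"
  have R: "0 < R" "R\<^sup>2 = real T" using T by (auto simp: R_def)
  define k where "k = min (1 / (4 * L)) (c / R ^ 3)"
  have k: "0 < k" using c R GL by (simp add: k_def)
  have \<eta>: "\<eta> t = real t * k" if "t \<in> {1..T}" for t
    using sched[OF that] by (simp add: k_def R_def min_mult_distrib_left mult.commute)
  have \<eta>_T: "\<eta> T = min (real T / (4 * L)) (c / R)"
    using \<eta>[of T] T R by (simp add: k_def min_mult_distrib_left power2_eq_square power3_eq_cube flip: R(2))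
  have \<eta>_T0: "0 < \<eta> T" using \<eta>[of T] T k by simp
  have A: "(\<Sum>t=1..T. (\<eta> t)\<^sup>2) \<le> real T * (\<eta> T)\<^sup>2"
  proof -
    have "(\<eta> t)\<^sup>2 \<le> (\<eta> T)\<^sup>2" if "t \<in> {1..T}" for t
      using \<eta>[OF that] \<eta>[of T] T k that by (intro power_mono) auto
    then have "(\<Sum>t=1..T. (\<eta> t)\<^sup>2) \<le> (\<Sum>t=1..T. (\<eta> T)\<^sup>2)" by (intro sum_mono)
    then show ?thesis by simp
  qed
  have sq1: "(\<Sum>t=1..T. (\<eta> t)\<^sup>2) \<le> 1 * c\<^sup>2"
  proof -
    have "(\<eta> T)\<^sup>2 \<le> (c / R)\<^sup>2" using \<eta>_T \<eta>_T0 by (intro power_mono) auto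
    then have "real T * (\<eta> T)\<^sup>2 \<le> real T * (c / R)\<^sup>2" by (intro mult_left_mono) auto
    also have "\<dots> = c\<^sup>2" using T by (simp add: power_divide R(2))
    finally show ?thesis using A by simp
  qed
  have sq2: "(\<Sum>t=1..T. (\<eta> t)\<^sup>2) \<le> 1 * (\<eta> T * (c / R) * (real T + 1))"
  proof -
    have "\<eta> T * \<eta> T \<le> \<eta> T * (c / R)" using \<eta>_T \<eta>_T0 by (intro mult_left_mono) auto
    then have "(\<eta> T * \<eta> T) * real T \<le> (\<eta> T * (c / R)) * (real T + 1)"
      by (rule mult_mono) (use \<eta>_T0 c R in auto)
    then show ?thesis using A by (simp add: power2_eq_square mult.commute)
  qed
  show ?thesis
    unfolding D\<^sub>0_def S_def
  proof (rule schedule_guarantee)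
    show "0 < \<delta>" "\<delta> < 1" by fact+
    show "0 < D xstar x\<^sub>0" using D\<^sub>0 by (simp add: D\<^sub>0_def)
    show "0 < \<eta> t" "\<eta> t \<le> real t / (4 * L)" if "t \<in> {1..T}" for t
      using \<eta>[OF that] sched[OF that] that k by auto
    show "real t * \<eta> (Suc t) \<le> (real t + 1) * \<eta> t" if "t \<in> {1..<T}" for t
      using \<eta>[of t] \<eta>[of "Suc t"] that by (simp add: add.commute)
  qed (use \<eta>_T sq1 sq2 in \<open>simp_all only: c_def R_def D\<^sub>0_def S_def\<close>)
qed

lemma inverse_sqrt_schedule_guarantee:
  fixes \<delta> :: real
  defines "S \<equiv> G\<^sup>2 + \<sigma>\<^sup>2 * (1 + ln (1 / \<delta>))" and "D\<^sub>0 \<equiv> D xstar x\<^sub>0"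
  defines "c \<equiv> sqrt D\<^sub>0 / (sqrt 6 * sqrt S)"
  assumes \<delta>: "0 < \<delta>" "\<delta> < 1" and D\<^sub>0: "0 < D\<^sub>0"
    and sched: "\<And>t. t \<in> {1..T} \<Longrightarrow> \<eta> t = min (real t / (4 * L)) (c / sqrt (real t))"
  shows "1 - \<delta> \<le> measure M {\<omega> \<in> space M.
    D xstar (z T \<omega>) \<le> (2 + 2 * (1 + ln (real T))) * D\<^sub>0 \<and>
    f (y T \<omega>) - f xstar \<le> 16 * L * D\<^sub>0 / (real T)\<^sup>2
      + 4 * sqrt 6 * (1 + (1 + ln (real T))) / sqrt (real T) * sqrt (D\<^sub>0 * S)}"
proof -
  have S: "0 < S" unfolding S_def by (rule noise_scale_pos[OF \<delta>])
  have c: "0 < c" using D\<^sub>0 S by (simp add: c_def)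
  define R where "R = sqrt (real T)"
  have R: "0 < R" "R\<^sup>2 = real T" using T by (auto simp: R_def)
  have \<eta>_pos: "0 < \<eta> t" if "t \<in> {1..T}" for t
    using sched[OF that] that c GL by simp
  have \<eta>_T: "\<eta> T = min (real T / (4 * L)) (c / R)" "0 < \<eta> T"
    using sched[of T] \<eta>_pos[of T] T by (simp_all add: R_def)
  have sq1: "(\<Sum>t=1..T. (\<eta> t)\<^sup>2) \<le> (1 + ln (real T)) * c\<^sup>2"
  proof -
    have "(\<eta> t)\<^sup>2 \<le> c\<^sup>2 * (1 / real t)" if "t \<in> {1..T}" for t
    proof -
      have "(\<eta> t)\<^sup>2 \<le> (c / sqrt (real t))\<^sup>2"
        using sched[OF that] \<eta>_pos[OF that] by (intro power_mono) auto
      then show ?thesis by (simp add: power_divide)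
    qed
    then have "(\<Sum>t=1..T. (\<eta> t)\<^sup>2) \<le> c\<^sup>2 * (\<Sum>t=1..T. 1 / real t)"
      unfolding sum_distrib_left by (intro sum_mono)
    also have "\<dots> \<le> c\<^sup>2 * (1 + ln (real T))" using sum_inverse_le_ln[OF T] by (intro mult_left_mono) auto
    finally show ?thesis by (simp add: mult.commute)
  qed
  have sq2: "(\<Sum>t=1..T. (\<eta> t)\<^sup>2) \<le> (1 + ln (real T)) * (\<eta> T * (c / R) * (real T + 1))"
  proof -
    have "(\<eta> t)\<^sup>2 \<le> \<eta> T * (c / R) * (real T + 1) * (1 / real t)" if t: "t \<in> {1..T}" for t
    proof -
      define r where "r = sqrt (real t)"
      have r: "0 < r" "r\<^sup>2 = real t" "r \<le> R" using t by (auto simp: r_def R_def)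
      have \<eta>_c: "\<eta> t \<le> c / r" using sched[OF t] by (simp add: r_def)
      \<comment> \<open>If the last step is \<open>c / R\<close>, then \<open>\<eta> t \<le> c / r\<close> is used for both factors, and otherwise
        \<open>\<eta> t \<le> t / (4 L)\<close> for one of them.\<close>
      have "\<eta> t * \<eta> t \<le> \<eta> T * (c / R) * (real T / real t)"
      proof (cases "\<eta> T = c / R")
        case True
        have "\<eta> t * \<eta> t \<le> c / r * (c / r)"
          using \<eta>_c \<eta>_pos[OF t] c r by (intro mult_mono) auto
        also have "\<dots> = \<eta> T * (c / R) * (real T / real t)"
          unfolding True r(2)[symmetric] R(2)[symmetric] using R(1) r(1)
          by (simp add: field_simps power2_eq_square)
        finally show ?thesis .
      next
        case False
        then have \<eta>T: "\<eta> T = real T / (4 * L)" using \<eta>_T(1) by (simp add: min_def split: if_splits)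
        have "\<eta> t \<le> real t / (4 * L)" using sched[OF t] by simp
        also have "\<dots> = \<eta> T * (real t / real T)" using T by (simp add: \<eta>T)
        finally have "\<eta> t * \<eta> t \<le> \<eta> T * (real t / real T) * (c / r)"
          using \<eta>_c \<eta>_pos[OF t] \<eta>_T(2) by (intro mult_mono) auto
        also have "\<dots> = \<eta> T * c * (r / R\<^sup>2)"
          unfolding r(2)[symmetric] R(2)[symmetric] using R(1) r(1)
          by (simp add: field_simps power2_eq_square)
        also have "\<dots> \<le> \<eta> T * c * (R / r\<^sup>2)"
        proof (rule mult_left_mono)
          have "r / R\<^sup>2 \<le> R / R\<^sup>2" using r R by (intro divide_right_mono) auto
          also have "\<dots> \<le> R / r\<^sup>2" using r R T t by (intro divide_left_mono power_mono) auto
          finally show "r / R\<^sup>2 \<le> R / r\<^sup>2" .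
        qed (use \<eta>_T(2) c in simp)
        also have "\<dots> = \<eta> T * (c / R) * (real T / real t)"
          unfolding r(2)[symmetric] R(2)[symmetric] using R(1) by (simp add: power2_eq_square)
        finally show ?thesis .
      qed
      also have "\<dots> \<le> \<eta> T * (c / R) * ((real T + 1) / real t)"
        using \<eta>_T(2) c R by (intro mult_left_mono divide_right_mono) auto
      finally show ?thesis by (simp add: power2_eq_square)
    qed
    then have "(\<Sum>t=1..T. (\<eta> t)\<^sup>2) \<le> \<eta> T * (c / R) * (real T + 1) * (\<Sum>t=1..T. 1 / real t)"
      unfolding sum_distrib_left by (intro sum_mono)
    also have "\<dots> \<le> \<eta> T * (c / R) * (real T + 1) * (1 + ln (real T))"
      using sum_inverse_le_ln[OF T] \<eta>_T(2) c R by (intro mult_left_mono) auto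
    finally show ?thesis by (simp add: mult.commute)
  qed
  show ?thesis
    unfolding D\<^sub>0_def S_def
  proof (rule schedule_guarantee)
    show "0 < \<delta>" "\<delta> < 1" by fact+
    show "0 < D xstar x\<^sub>0" using D\<^sub>0 by (simp add: D\<^sub>0_def)
    show "0 < \<eta> t" "\<eta> t \<le> real t / (4 * L)" if "t \<in> {1..T}" for t
      using sched[OF that] \<eta>_pos[OF that] by auto
    show "real t * \<eta> (Suc t) \<le> (real t + 1) * \<eta> t" if t: "t \<in> {1..<T}" for t
    proof -
      have t': "t \<in> {1..T}" "Suc t \<in> {1..T}" using t by auto
      show ?thesis
      proof (cases "\<eta> t = real t / (4 * L)")
        case True
        have "real t * \<eta> (Suc t) \<le> real t * (real (Suc t) / (4 * L))"
          using sched[OF t'(2)] by (intro mult_left_mono) auto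
        also have "\<dots> = (real t + 1) * \<eta> t" by (simp add: True)
        finally show ?thesis .
      next
        case False
        then have \<eta>t: "\<eta> t = c / sqrt (real t)"
          using sched[OF t'(1)] by (simp add: min_def split: if_splits)
        have "\<eta> (Suc t) \<le> c / sqrt (real (Suc t))" using sched[OF t'(2)] by simp
        also have "\<dots> \<le> \<eta> t" unfolding \<eta>t using c t by (intro divide_left_mono) auto
        finally show ?thesis using \<eta>_pos[OF t'(2)] by (intro mult_mono) auto
      qed
    qed
  qed (use \<eta>_T(1) sq1 sq2 in \<open>simp_all only: c_def R_def D\<^sub>0_def S_def\<close>)
qed

lemma stationary_guarantee:
  assumes "D xstar x\<^sub>0 = 0" and \<eta>: "\<And>t. t \<in> {1..T} \<Longrightarrow> \<eta> t = 0"
  shows "measure M {\<omega> \<in> space M. D xstar (z T \<omega>) \<le> 0 \<and> f (y T \<omega>) - f xstar \<le> 0} = 1"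
proof -
  have "xstar = x\<^sub>0" using bregman_eq_zero[OF xstar_in start] assms(1) by simp
  then have "D xstar (z T \<omega>) \<le> 0 \<and> f (y T \<omega>) - f xstar \<le> 0" if "\<omega> \<in> space M" for \<omega>
    using stationary_path[OF run[OF that] \<eta>, of T] by (simp add: bregman_self)
  then have "{\<omega> \<in> space M. D xstar (z T \<omega>) \<le> 0 \<and> f (y T \<omega>) - f xstar \<le> 0} = space M" by blast
  then show ?thesis by (simp add: prob_space)
qed

end

theorem theoremB3:
  fixes M :: "'w measure"
    and X :: "(real ^ 'd) set"
    and N :: "real ^ 'd \<Rightarrow> real"
    and f \<psi> :: "real ^ 'd \<Rightarrow> real"
    and grad_f grad_\<psi> :: "real ^ 'd \<Rightarrow> real ^ 'd"
    and G L \<sigma> \<delta> :: real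
    and T :: nat
    and x\<^sub>0 xstar :: "real ^ 'd"
    and \<eta> :: "nat \<Rightarrow> real"
    and g x y z \<xi> :: "nat \<Rightarrow> 'w \<Rightarrow> real ^ 'd"
  defines "\<xi> \<equiv> (\<lambda>t \<omega>. g t \<omega> - grad_f (x t \<omega>))"
    and "S \<equiv> G\<^sup>2 + \<sigma>\<^sup>2 * (1 + ln (1 / \<delta>))"
    and "D\<^sub>0 \<equiv> bregman \<psi> grad_\<psi> xstar x\<^sub>0"
  assumes prob: "prob_space M"
    and X: "convex X" "X \<noteq> {}"
    and N: "is_norm N"
    and f_convex: "convex_on UNIV f"
    and f_grad: "\<And>u. GDERIV f u :> grad_f u"
    and \<psi>_grad: "\<And>u. GDERIV \<psi> u :> grad_\<psi> u"
    and \<psi>_strong: "strongly_convex_on X 1 N \<psi>"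
    and params: "G \<ge> 0" "L > 0" "\<sigma> > 0" "0 < \<delta>" "\<delta> < 1" "T \<ge> 1"
    and smooth: "\<And>u v. u \<in> X \<Longrightarrow> v \<in> X \<Longrightarrow>
        f v \<le> f u + grad_f u \<bullet> (v - u) + G * N (v - u) + L / 2 * (N (v - u))\<^sup>2"
    and minimizer: "is_arg_min f (\<lambda>u. u \<in> X) xstar"
    and start: "x\<^sub>0 \<in> X"
    and run: "\<And>\<omega>. \<omega> \<in> space M \<Longrightarrow>
        asmd_path X \<psi> grad_\<psi> \<eta> T x\<^sub>0 (\<lambda>t. g t \<omega>) (\<lambda>t. x t \<omega>) (\<lambda>t. y t \<omega>) (\<lambda>t. z t \<omega>)"
    and oracle_meas: "\<And>t. t \<in> {1..T} \<Longrightarrow> g t \<in> borel_measurable M"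
    and unbiased: "\<And>t. t \<in> {1..T} \<Longrightarrow> cond_mean_zero M (noise_history M \<xi> t) (\<xi> t)"
    and subgaussian: "\<And>t. t \<in> {1..T} \<Longrightarrow>
        cond_subgaussian M (noise_history M \<xi> t) \<sigma> (\<lambda>\<omega>. dual_norm N (\<xi> t \<omega>))"
  shows
    "((\<forall>t\<in>{1..T}. \<eta> t = min (real t / (4 * L))
          (sqrt D\<^sub>0 * real t / (sqrt 6 * sqrt S * real T powr (3 / 2)))) \<longrightarrow>
        measure M {\<omega> \<in> space M.
          bregman \<psi> grad_\<psi> xstar (z T \<omega>) \<le> 4 * D\<^sub>0 \<and>
          f (y T \<omega>) - f xstar \<le> 16 * L * D\<^sub>0 / (real T)\<^sup>2 + 8 * sqrt 6 / sqrt (real T) * sqrt (D\<^sub>0 * S)}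
        \<ge> 1 - \<delta>)
     \<and>
     ((\<forall>t\<in>{1..T}. \<eta> t = min (real t / (4 * L))
          (sqrt D\<^sub>0 / (sqrt 6 * sqrt S * real t powr (1 / 2)))) \<longrightarrow>
        measure M {\<omega> \<in> space M.
          bregman \<psi> grad_\<psi> xstar (z T \<omega>) \<le> 2 * (2 + ln (real T)) * D\<^sub>0 \<and>
          f (y T \<omega>) - f xstar \<le> 16 * L * D\<^sub>0 / (real T)\<^sup>2
            + 4 * sqrt 6 * (2 + ln (real T)) / sqrt (real T) * sqrt (D\<^sub>0 * S)}
        \<ge> 1 - \<delta>)"
proof -
  interpret prob_space M by (rule prob)
  interpret stochastic_run N X \<psi> grad_\<psi> f grad_f G L xstar x\<^sub>0 M T \<eta> \<sigma> g x y z
    "\<lambda>t \<omega>. g t \<omega> - grad_f (x t \<omega>)"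
    by unfold_locales (use assms in \<open>auto simp: \<xi>_def\<close>)
  have "0 \<le> D\<^sub>0" unfolding D\<^sub>0_def by (rule bregman_nonneg[OF xstar_in start])
  then consider (degenerate) "D\<^sub>0 = 0" | (positive) "0 < D\<^sub>0" by linarith
  then show ?thesis
  proof cases
    case degenerate
    \<comment> \<open>Both schedules vanish identically and the iterates never leave the minimizer.\<close>
    have steps: "\<eta> t = 0"
      if "\<eta> t = min (real t / (4 * L)) (sqrt D\<^sub>0 * real t / (sqrt 6 * sqrt S * real T powr (3 / 2))) \<or>
        \<eta> t = min (real t / (4 * L)) (sqrt D\<^sub>0 / (sqrt 6 * sqrt S * real t powr (1 / 2)))" for t
      using that degenerate params by (auto simp: min.absorb2)
    have "1 - \<delta> \<le> measure M {\<omega> \<in> space M.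
        bregman \<psi> grad_\<psi> xstar (z T \<omega>) \<le> 0 \<and> f (y T \<omega>) - f xstar \<le> 0}"
      if "\<And>t. t \<in> {1..T} \<Longrightarrow> \<eta> t = 0"
      using stationary_guarantee[OF degenerate[unfolded D\<^sub>0_def] that] params by simp
    then show ?thesis using degenerate steps by simp
  next
    case positive
    have powr: "real T powr (3 / 2) = sqrt (real T) ^ 3"
    proof -
      have "real T powr (3 / 2) = (real T powr (1 / 2)) powr 3" by (simp add: powr_powr)
      then show ?thesis using T by (simp add: powr_half_sqrt powr_numeral)
    qed
    note guarantees = linear_schedule_guarantee inverse_sqrt_schedule_guarantee
    note guarantees = guarantees[OF params(4,5), folded D\<^sub>0_def, folded S_def, OF positive]
    show ?thesis
    proof (intro conjI impI)
      assume sched: "\<forall>t\<in>{1..T}. \<eta> t = min (real t / (4 * L))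
          (sqrt D\<^sub>0 * real t / (sqrt 6 * sqrt S * real T powr (3 / 2)))"
      have "\<eta> t = min (real t / (4 * L)) (sqrt D\<^sub>0 / (sqrt 6 * sqrt S) * real t / sqrt (real T) ^ 3)"
        if "t \<in> {1..T}" for t
        using bspec[OF sched that] by (simp add: powr)
      from guarantees(1)[OF this] show "1 - \<delta> \<le> measure M {\<omega> \<in> space M.
          bregman \<psi> grad_\<psi> xstar (z T \<omega>) \<le> 4 * D\<^sub>0 \<and>
          f (y T \<omega>) - f xstar \<le> 16 * L * D\<^sub>0 / (real T)\<^sup>2 + 8 * sqrt 6 / sqrt (real T) * sqrt (D\<^sub>0 * S)}"
        by simp
    next
      assume sched: "\<forall>t\<in>{1..T}. \<eta> t = min (real t / (4 * L))
          (sqrt D\<^sub>0 / (sqrt 6 * sqrt S * real t powr (1 / 2)))"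
      have "\<eta> t = min (real t / (4 * L)) (sqrt D\<^sub>0 / (sqrt 6 * sqrt S) / sqrt (real t))"
        if "t \<in> {1..T}" for t
        using bspec[OF sched that] by (simp add: powr_half_sqrt)
      moreover have "2 + 2 * (1 + l) = 2 * (2 + l)" "1 + (1 + l) = 2 + l" for l :: real by simp_all
      ultimately show "1 - \<delta> \<le> measure M {\<omega> \<in> space M.
          bregman \<psi> grad_\<psi> xstar (z T \<omega>) \<le> 2 * (2 + ln (real T)) * D\<^sub>0 \<and>
          f (y T \<omega>) - f xstar \<le> 16 * L * D\<^sub>0 / (real T)\<^sup>2
            + 4 * sqrt 6 * (2 + ln (real T)) / sqrt (real T) * sqrt (D\<^sub>0 * S)}"
        using guarantees(2) by simp
    qed
  qed
qed

end
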